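(* Let $1\le p_0<\infty$ and let $f$ and $g$ be two positive measurable functions on $\mathbb R^n$ such that, for every $w\in A_{p_0}$, $$\|g\|_{L^{p_0,\infty}(w)}\le \varphi(\|w\|_{A_{p_0}})\,\|f\|_{L^{p_0}(w)},$$ where $\varphi$ is a locally bounded function. Then, for every $0<\mu<1$, every $0<\delta<1$, every positive locally integrable function $u$ on $\mathbb R^n$ and every $y>0$, $$\lambda^u_g(y)\le C\Big(c_{p_0}\lambda^u_{M_\delta f}(y)+\frac1{y}\int_{\mathbb R^n} f(x)\,M_\mu(u\chi_{\{g>y\}})(x)\,dx\Big),$$ where $c_{p_0}=1$ if $p_0>1$ and $c_{p_0}=0$ if $p_0=1$, and the constant $C$ is independent of $f$, $g$, $u$ and $y$ (it may depend on $n,p_0,\mu,\delta,\varphi$).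
   Context: $Mf(x)=\sup_{x\in Q}\frac1{|Q|}\int_Q|f|$ is the Hardy–Littlewood maximal operator (supremum over cubes $Q\subset\mathbb R^n$ containing $x$). For $0<\mu<1$, $M_\mu f(x)=\big(M(|f|^{1/\mu})(x)\big)^\mu$. For a function $g$ and a positive locally integrable $u$, $\lambda_g^u(y)=u(\{x: |g(x)|>y\})=\int_{\{|g|>y\}}u\,dx$. $\|g\|_{L^{p,\infty}(w)}=\sup_{y>0}y\,\lambda_g^w(y)^{1/p}$. $A_p$ is the Muckenhoupt class of weights with $\|w\|_{A_p}=\sup_Q\big(\frac1{|Q|}\int_Qw\big)\big(\frac1{|Q|}\int_Qw^{-1/(p-1)}\big)^{p-1}<\infty$ for $1<p<\infty$, and $\|w\|_{A_1}=\sup_Q\big(\frac1{|Q|}\int_Qw\big)\|w^{-1}\|_{L^\infty(Q)}<\infty$ for $p=1$. A function $\varphi$ on $(0,\infty)$ is locally bounded if $\sup_{0<t<K}\varphi(t)<\infty$ for every $K>0$. *)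

theory Defs
  imports "HOL-Analysis.Analysis" "HOL-Probability.Essential_Supremum"
begin

text \<open>All integrals are with respect to Lebesgue measure and take values in $[0,\infty]$, so that norms,
  distribution functions and maximal functions need no integrability assumptions.\<close>

definition cubes :: "(real ^ 'n) set set" where
  "cubes = {cbox a (\<chi> i. a $ i + l) | a l. 0 < l}"

definition average :: "(real ^ 'n) set \<Rightarrow> (real ^ 'n \<Rightarrow> real) \<Rightarrow> ennreal" where
  "average Q f = (\<integral>\<^sup>+ x \<in> Q. ennreal (f x) \<partial>lebesgue) / emeasure lebesgue Q"

text \<open>The power $x^s$ on $[0,\infty]$, meant for $s > 0$.\<close>

definition epowr :: "ennreal \<Rightarrow> real \<Rightarrow> ennreal" where
  "epowr x s = (if x = \<infinity> then \<infinity> else ennreal (enn2real x powr s))"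

definition maximal :: "(real ^ 'n \<Rightarrow> real) \<Rightarrow> real ^ 'n \<Rightarrow> ennreal" where
  "maximal f x = (SUP Q \<in> {Q \<in> cubes. x \<in> Q}. average Q (\<lambda>y. \<bar>f y\<bar>))"

definition maximal_pow :: "real \<Rightarrow> (real ^ 'n \<Rightarrow> real) \<Rightarrow> real ^ 'n \<Rightarrow> ennreal" where
  "maximal_pow \<mu> f x = epowr (maximal (\<lambda>y. \<bar>f y\<bar> powr (1 / \<mu>)) x) \<mu>"

text \<open>The distribution function of $|g|$ with respect to $u\,dx$. The first function argument is $|g|$ itself, with
  values in $[0,\infty]$: maximal functions may take the value $\infty$.\<close>

definition distr_fun :: "(real ^ 'n \<Rightarrow> real) \<Rightarrow> (real ^ 'n \<Rightarrow> ennreal) \<Rightarrow> real \<Rightarrow> ennreal" where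
  "distr_fun u h y = (\<integral>\<^sup>+ x \<in> {x. h x > ennreal y}. ennreal (u x) \<partial>lebesgue)"

definition weak_Lp_norm :: "real \<Rightarrow> (real ^ 'n \<Rightarrow> real) \<Rightarrow> (real ^ 'n \<Rightarrow> real) \<Rightarrow> ennreal" where
  "weak_Lp_norm p w g =
     (SUP y \<in> {0<..}. ennreal y * epowr (distr_fun w (\<lambda>x. ennreal \<bar>g x\<bar>) y) (1 / p))"

definition Lp_norm :: "real \<Rightarrow> (real ^ 'n \<Rightarrow> real) \<Rightarrow> (real ^ 'n \<Rightarrow> real) \<Rightarrow> ennreal" where
  "Lp_norm p w f = epowr (\<integral>\<^sup>+ x. ennreal (\<bar>f x\<bar> powr p * w x) \<partial>lebesgue) (1 / p)"

definition locally_integrable :: "(real ^ 'n \<Rightarrow> real) \<Rightarrow> bool" where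
  "locally_integrable u \<longleftrightarrow> (\<forall>K. compact K \<longrightarrow> u absolutely_integrable_on K)"

definition weight :: "(real ^ 'n \<Rightarrow> real) \<Rightarrow> bool" where
  "weight w \<longleftrightarrow> locally_integrable w \<and> (AE x in lebesgue. 0 < w x)"

definition Muckenhoupt_const :: "real \<Rightarrow> (real ^ 'n \<Rightarrow> real) \<Rightarrow> ennreal" where
  "Muckenhoupt_const p w =
     (if p = 1
      then (SUP Q \<in> cubes. average Q w * esssup (restrict_space lebesgue Q) (\<lambda>x. ennreal (inverse (w x))))
      else (SUP Q \<in> cubes. average Q w * epowr (average Q (\<lambda>x. w x powr (- 1 / (p - 1)))) (p - 1)))"

definition Muckenhoupt :: "real \<Rightarrow> (real ^ 'n \<Rightarrow> real) set" where
  "Muckenhoupt p = {w. weight w \<and> Muckenhoupt_const p w < \<infinity>}"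

definition Muckenhoupt_norm :: "real \<Rightarrow> (real ^ 'n \<Rightarrow> real) \<Rightarrow> real" where
  "Muckenhoupt_norm p w = enn2real (Muckenhoupt_const p w)"

text \<open>Local boundedness up to the endpoint 0, for a function on $(0,\infty)$; its values elsewhere are ignored.\<close>

definition locally_bounded :: "(real \<Rightarrow> real) \<Rightarrow> bool" where
  "locally_bounded \<phi> \<longleftrightarrow> (\<forall>K>0. bdd_above (\<phi> ` {0<..<K}))"

end

theory Submission
  imports Defs
begin

text \<open>
  Let $G = \{g > y\}$, $U = M_\mu(u\chi_G)$ and $V = M_\delta f$. By Coifman and Rochberg both $U$ and $V$ are
  $A_1$ weights whose constants depend only on the dimension and the exponent, so $w = U V^{1-p_0}$ lies
  in $A_{p_0}$ with uniformly controlled constant and the hypothesis applies to it. By Lebesgue differentiation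
  $u \le U$ on $G$ and $f \le V$ almost everywhere. Outside $\{V > y\}$ one has $1 \le (y/V)^{p_0-1}$, whence
  $u(G) \le u(V > y) + y^{p_0-1} w(G)$, and the weak-type bound gives
  $y^{p_0} w(G) \lesssim \int f^{p_0} V^{1-p_0} U \le \int f U$. For $p_0 = 1$ the weight is $U$ itself and no splitting is needed.
  If $U$ or $V$ is identically infinite, the right-hand side already dominates; if $f$ vanishes almost
  everywhere, the constant weight shows that $g \le y$ almost everywhere.
\<close>

text \<open>The exponents \<mu>, \<delta> < 1 are what make the weights available. In general M F is
  not an A_1 weight and need not even be locally integrable, whereas (M F)^\<mu>, if finite
  somewhere and nonzero, is A_1 with a constant independent of F. Two effects combine: averages over
  large cubes are comparable at all points of a fixed cube, and the weak type (1,1) bound for the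
  remaining local part of F makes the dyadic levels of the \<mu>-th power contribute a geometric
  series of ratio 2^(\<mu>-1). The same estimate gives a dichotomy: finiteness at one point spreads
  almost everywhere, so an infinite maximal function is a problem only if it is infinite everywhere.
  The other obstruction is positivity, which fails for U or V only if u times the indicator of G, or
  f, vanishes almost everywhere. Uniformity comes from the easy half of the factorization of A_p
  weights, which yields the constant c d^(p-1). Hence \<phi> matters only on a fixed bounded
  interval, and its bound there enters C. Since f is merely measurable, the comparison with its
  maximal function is proved on sets where the latter is bounded, without local integrability of
  f.\<close>

section \<open>Cubes and the weak type (1,1) inequality\<close>

text \<open>As a simp rule this would rewrite the Lebesgue measure of a set to that of its Borel main part.\<close>
declare emeasure_completion [simp del]

definition cube :: "real ^ 'n \<Rightarrow> real \<Rightarrow> (real ^ 'n) set" where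
  "cube a l = cbox a (\<chi> i. a $ i + l)"

lemma mem_cube: "x \<in> cube a l \<longleftrightarrow> (\<forall>i. a $ i \<le> x $ i \<and> x $ i \<le> a $ i + l)"
  by (simp add: cube_def mem_box_cart)

lemma cubesE:
  assumes "Q \<in> cubes" obtains a l where "0 < l" "Q = cube a l"
  using assms by (auto simp: cubes_def cube_def)

lemma cube_in_cubes: "0 < l \<Longrightarrow> cube a l \<in> cubes"
  by (auto simp: cubes_def cube_def)

lemma sets_cube [measurable, simp]: "cube a l \<in> sets lebesgue"
  by (simp add: cube_def)

lemma emeasure_cube:
  fixes a :: "real ^ 'n"
  assumes "0 \<le> l" shows "emeasure lebesgue (cube a l) = ennreal (l ^ CARD('n))"
proof -
  have "cbox a (\<chi> i. a $ i + l) \<noteq> {}"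
    using assms by (auto simp: interval_eq_empty_cart not_less)
  from content_cbox_cart[OF this] have "measure lborel (cube a l) = l ^ CARD('n)"
    by (simp add: cube_def)
  moreover have "emeasure lebesgue (cube a l) = ennreal (measure lborel (cube a l))"
    unfolding cube_def by (subst emeasure_eq_ennreal_measure) (auto simp: emeasure_completion emeasure_lborel_cbox_eq)
  ultimately show ?thesis by simp
qed

lemma average_cube:
  fixes a :: "real ^ 'n"
  assumes "0 < l"
  shows "average (cube a l) f = (\<integral>\<^sup>+ x \<in> cube a l. ennreal (f x) \<partial>lebesgue) * ennreal (1 / l ^ CARD('n))"
  using assms by (simp add: average_def emeasure_cube divide_ennreal_def inverse_ennreal inverse_eq_divide)

lemma average_le_maximal: "Q \<in> cubes \<Longrightarrow> x \<in> Q \<Longrightarrow> average Q (\<lambda>y. \<bar>f y\<bar>) \<le> maximal f x"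
  unfolding maximal_def by (intro SUP_upper) auto

text \<open>Passing to the larger cube increases the integral, while the volume grows by at most
  k^n.\<close>

lemma average_cube_subset:
  fixes a b :: "real ^ 'n"
  assumes "0 < l" "0 < m" "m \<le> k * l" "cube a l \<subseteq> cube b m"
  shows "average (cube a l) f \<le> ennreal (k ^ CARD('n)) * average (cube b m) f"
proof -
  have k: "0 < k" using assms by (smt (verit) mult_nonpos_nonneg)
  let ?I = "\<lambda>Q. \<integral>\<^sup>+ x \<in> Q. ennreal (f x) \<partial>lebesgue"
  have "1 / l ^ CARD('n) \<le> k ^ CARD('n) * (1 / m ^ CARD('n))"
  proof -
    have "m ^ CARD('n) \<le> (k * l) ^ CARD('n)" using assms by (intro power_mono) auto
    then show ?thesis using assms by (simp add: divide_simps power_mult_distrib mult.commute)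
  qed
  then have *: "ennreal (1 / l ^ CARD('n)) \<le> ennreal (k ^ CARD('n)) * ennreal (1 / m ^ CARD('n))"
    using k by (simp add: ennreal_mult[symmetric] ennreal_leI assms(2) less_imp_le)
  have "?I (cube a l) \<le> ?I (cube b m)"
    using assms(4) by (intro nn_integral_mono) (auto split: split_indicator)
  then have "?I (cube a l) * ennreal (1 / l ^ CARD('n))
      \<le> ?I (cube b m) * (ennreal (k ^ CARD('n)) * ennreal (1 / m ^ CARD('n)))"
    using * by (intro mult_mono) auto
  then show ?thesis by (simp add: average_cube assms mult_ac)
qed

text \<open>Cubes are closed, so x may lie on the boundary of the cube that witnesses a large
  average. Enlarging this cube slightly on all sides keeps the average above t and makes it contain
  a whole ball around x.\<close>

lemma open_maximal_greater:
  fixes f :: "real ^ 'n \<Rightarrow> real"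
  shows "open {x. t < maximal f x}"
proof (subst open_contains_ball, intro ballI)
  fix x assume "x \<in> {x. t < maximal f x}"
  then obtain Q where Q: "Q \<in> cubes" "x \<in> Q" "t < average Q (\<lambda>y. \<bar>f y\<bar>)"
    by (auto simp: maximal_def less_SUP_iff)
  then obtain a l where l: "0 < l" and Qal: "Q = cube a l" by (auto elim: cubesE)
  define I where "I = (\<integral>\<^sup>+ x \<in> cube a l. ennreal \<bar>f x\<bar> \<partial>lebesgue)"
  let ?n = "CARD('n)"
  \<comment> \<open>For a finite integral the strict inequality at e = 0 persists for small e by
    continuity; multiplication by \<infinity> is not continuous at 0, so an infinite integral is
    treated directly.\<close>
  have "\<exists>e>0. t < I * ennreal (1 / (l + 2 * e) ^ ?n)"
  proof (cases "I = \<infinity>")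
    case True
    then show ?thesis using less_le_trans[OF Q(3) top_greatest] l by (intro exI[of _ 1]) (auto simp: ennreal_top_mult add_pos_pos)
  next
    case False
    have "((\<lambda>e. 1 / (l + 2 * e) ^ ?n) \<longlongrightarrow> 1 / (l + 2 * 0) ^ ?n) (at_right 0)"
      using l by (intro tendsto_intros) auto
    then have "((\<lambda>e. I * ennreal (1 / (l + 2 * e) ^ ?n)) \<longlongrightarrow> I * ennreal (1 / (l + 2 * 0) ^ ?n)) (at_right 0)"
      using False by (intro ennreal_tendsto_cmult tendsto_ennrealI) (auto simp: less_top)
    moreover have "t < I * ennreal (1 / (l + 2 * 0) ^ ?n)"
      using Q(3) l by (simp add: Qal average_cube I_def)
    ultimately have "\<forall>\<^sub>F e in at_right 0. t < I * ennreal (1 / (l + 2 * e) ^ ?n)"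
      by (rule order_tendstoD)
    then have "\<forall>\<^sub>F e in at_right 0. 0 < e \<and> t < I * ennreal (1 / (l + 2 * e) ^ ?n)"
      using eventually_at_right_less[of "0::real"] by eventually_elim auto
    then show ?thesis
      using eventually_happens'[OF trivial_limit_at_right_real] by blast
  qed
  then obtain e where e: "0 < e" "t < I * ennreal (1 / (l + 2 * e) ^ ?n)" by blast
  define R where "R = cube (\<chi> i. a $ i - e) (l + 2 * e)"
  have "cube a l \<subseteq> R"
  proof
    fix z assume z: "z \<in> cube a l"
    have "a $ i - e \<le> z $ i \<and> z $ i \<le> a $ i - e + (l + 2 * e)" for i
      using z[unfolded mem_cube, rule_format, of i] e(1) by simp
    then show "z \<in> R" by (simp add: R_def mem_cube)
  qed
  then have "I \<le> (\<integral>\<^sup>+ x \<in> R. ennreal \<bar>f x\<bar> \<partial>lebesgue)"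
    unfolding I_def by (intro nn_integral_mono) (auto split: split_indicator)
  then have R: "t < average R (\<lambda>y. \<bar>f y\<bar>)"
    using e l by (auto simp: R_def average_cube intro!: less_le_trans[OF e(2)] mult_right_mono)
  have "ball x e \<subseteq> {x. t < maximal f x}"
  proof
    fix z assume z: "z \<in> ball x e"
    have "\<bar>z $ i - x $ i\<bar> < e" for i
      using z component_le_norm_cart[of "z - x" i] by (auto simp: dist_norm norm_minus_commute)
    then have "z \<in> R" using Q(2) unfolding Qal R_def mem_cube
      by (auto simp: abs_less_iff algebra_simps) (smt (verit))+
    then show "z \<in> {x. t < maximal f x}"
      using R average_le_maximal[of R z f] e l by (auto simp: R_def cube_in_cubes)
  qed
  then show "\<exists>e>0. ball x e \<subseteq> {x. t < maximal f x}" using e by blast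
qed

lemma maximal_measurable [measurable]: "maximal f \<in> borel_measurable lebesgue"
proof (rule borel_measurableI_greater)
  fix t show "{x \<in> space lebesgue. t < maximal f x} \<in> sets lebesgue"
    using open_maximal_greater[of t f] by (simp add: borel_open)
qed

section \<open>Covering argument for the weak type inequality\<close>

text \<open>Countable subadditivity with the sum written as an integral over counting measure, so
  that the families produced by covering theorems need not be enumerated.\<close>

lemma emeasure_UN_le_nn_integral:
  assumes "countable I" "\<And>i. i \<in> I \<Longrightarrow> X i \<in> sets M"
  shows "emeasure M (\<Union>i\<in>I. X i) \<le> (\<integral>\<^sup>+ i. emeasure M (X i) \<partial>count_space I)"
proof -
  have "(\<Union>i\<in>I. X i) \<in> sets M" using assms by auto
  then have "emeasure M (\<Union>i\<in>I. X i) = (\<integral>\<^sup>+ x. indicator (\<Union>i\<in>I. X i) x \<partial>M)" by simp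
  also have "\<dots> \<le> (\<integral>\<^sup>+ x. \<integral>\<^sup>+ i. indicator (X i) x \<partial>count_space I \<partial>M)"
  proof (intro nn_integral_mono)
    fix x
    show "indicator (\<Union>i\<in>I. X i) x \<le> (\<integral>\<^sup>+ i. indicator (X i) x \<partial>count_space I)"
    proof (cases "x \<in> (\<Union>i\<in>I. X i)")
      case True
      then obtain i where i: "i \<in> I" "x \<in> X i" by auto
      then have "(1::ennreal) \<le> indicator (X i) x" by simp
      also have "\<dots> \<le> (\<integral>\<^sup>+ i. indicator (X i) x \<partial>count_space I)"
        using i by (intro nn_integral_ge_point) auto
      finally show ?thesis using True by simp
    qed simp
  qed
  also have "\<dots> = (\<integral>\<^sup>+ i. \<integral>\<^sup>+ x. indicator (X i) x \<partial>M \<partial>count_space I)"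
    using assms by (intro nn_integral_count_space_nn_integral) auto
  also have "\<dots> = (\<integral>\<^sup>+ i. emeasure M (X i) \<partial>count_space I)"
    using assms by (intro nn_integral_cong) auto
  finally show ?thesis .
qed

text \<open>Integrals over the pieces are their measures under \<open>density M f\<close>, whose
  countable additivity bounds the sum by the total mass.\<close>

lemma nn_integral_disjoint_le:
  assumes "countable I" "\<And>i. i \<in> I \<Longrightarrow> X i \<in> sets M" "disjoint_family_on X I" "f \<in> borel_measurable M"
  shows "(\<integral>\<^sup>+ i. (\<integral>\<^sup>+ x \<in> X i. f x \<partial>M) \<partial>count_space I) \<le> (\<integral>\<^sup>+ x. f x \<partial>M)"
proof -
  have "(\<integral>\<^sup>+ i. (\<integral>\<^sup>+ x \<in> X i. f x \<partial>M) \<partial>count_space I) = (\<integral>\<^sup>+ i. emeasure (density M f) (X i) \<partial>count_space I)"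
    using assms by (intro nn_integral_cong) (simp add: emeasure_density)
  also have "\<dots> = emeasure (density M f) (\<Union>i\<in>I. X i)"
    using assms by (intro emeasure_UN_countable[symmetric]) auto
  also have "\<dots> \<le> emeasure (density M f) (space M)"
    by (rule emeasure_mono) (use assms sets.sets_into_space in auto)
  also have "\<dots> = (\<integral>\<^sup>+ x. f x \<partial>M)"
    using assms by (subst emeasure_density) (auto intro!: nn_integral_cong)
  finally show ?thesis .
qed

text \<open>Vitali's lemma is applied to balls around the cubes. A cube of side l lies in the ball
  of radius n l about its corner, and the fivefold ball lies in a cube of side 10 n l; this is the
  origin of (10 n)^n.\<close>

lemma maximal_weak_type:
  fixes f :: "real ^ 'n \<Rightarrow> real"
  assumes f [measurable]: "f \<in> borel_measurable lebesgue" and t: "0 < t"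
  shows "ennreal t * emeasure lebesgue {x. ennreal t < maximal f x}
    \<le> ennreal ((10 * CARD('n)) ^ CARD('n)) * (\<integral>\<^sup>+ x. ennreal \<bar>f x\<bar> \<partial>lebesgue)"
proof (cases "(\<integral>\<^sup>+ x. ennreal \<bar>f x\<bar> \<partial>lebesgue) = \<infinity>")
  case True
  then show ?thesis by (simp add: ennreal_mult_top)
next
  case False
  let ?n = "CARD('n)"
  obtain c where c: "0 \<le> c" "(\<integral>\<^sup>+ x. ennreal \<bar>f x\<bar> \<partial>lebesgue) = ennreal c"
    using False by (cases "(\<integral>\<^sup>+ x. ennreal \<bar>f x\<bar> \<partial>lebesgue)") auto
  define J where "J = {(a :: real ^ 'n, l). 0 < l \<and> ennreal t < average (cube a l) (\<lambda>y. \<bar>f y\<bar>)}"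
  have J: "ennreal t * emeasure lebesgue (cube a l) \<le> (\<integral>\<^sup>+ x \<in> cube a l. ennreal \<bar>f x\<bar> \<partial>lebesgue)"
    and Jl: "0 < l" if "(a, l) \<in> J" for a l
  proof -
    show l: "0 < l" using that by (simp add: J_def)
    have "ennreal t \<le> (\<integral>\<^sup>+ x \<in> cube a l. ennreal \<bar>f x\<bar> \<partial>lebesgue) * ennreal (1 / l ^ ?n)"
      using that by (auto simp: J_def average_cube)
    then have "ennreal t * ennreal (l ^ ?n)
        \<le> (\<integral>\<^sup>+ x \<in> cube a l. ennreal \<bar>f x\<bar> \<partial>lebesgue) * (ennreal (1 / l ^ ?n) * ennreal (l ^ ?n))"
      by (simp add: mult.assoc[symmetric] mult_right_mono)
    also have "ennreal (1 / l ^ ?n) * ennreal (l ^ ?n) = 1"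
      using l by (simp add: ennreal_mult[symmetric])
    finally show "ennreal t * emeasure lebesgue (cube a l) \<le> (\<integral>\<^sup>+ x \<in> cube a l. ennreal \<bar>f x\<bar> \<partial>lebesgue)"
      using l by (simp add: emeasure_cube)
  qed
  \<comment> \<open>Vitali's lemma needs bounded radii. The integral c of |f| bounds t l^n, and l is
    at most l^n once l > 1.\<close>
  have Jb: "l \<le> max 1 (c / t)" if "(a, l) \<in> J" for a l
  proof (cases "l \<le> 1")
    case False
    have "(\<integral>\<^sup>+ x \<in> cube a l. ennreal \<bar>f x\<bar> \<partial>lebesgue) \<le> ennreal c"
      unfolding c(2)[symmetric] by (intro nn_integral_mono) (auto split: split_indicator)
    then have "ennreal t * emeasure lebesgue (cube a l) \<le> ennreal c"
      using J[OF that] by (rule order_trans[rotated])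
    then have "t * l ^ ?n \<le> c"
      using t Jl[OF that] c(1) by (simp add: emeasure_cube ennreal_mult[symmetric])
    then have "l ^ ?n \<le> c / t" using t by (simp add: field_simps)
    moreover have "l \<le> l ^ ?n" using False by (intro self_le_power) auto
    ultimately show ?thesis by simp
  qed simp
  have sub: "cube a l \<subseteq> cball a (?n * l)" for a :: "real ^ 'n" and l :: real
  proof
    fix x assume "x \<in> cube a l"
    then have "\<bar>(x - a) $ i\<bar> \<le> l" for i by (smt (verit) mem_cube vector_minus_component)
    then have "(\<Sum>i\<in>UNIV. \<bar>(x - a) $ i\<bar>) \<le> ?n * l" by (intro sum_bounded_above) auto
    then show "x \<in> cball a (?n * l)"
      using norm_le_l1_cart[of "x - a"] by (simp add: dist_norm norm_minus_commute)
  qed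
  have sup: "cball a (5 * (?n * l)) \<subseteq> cube (\<chi> i. a $ i - 5 * ?n * l) (10 * ?n * l)" for a :: "real ^ 'n" and l :: real
  proof
    fix x assume x: "x \<in> cball a (5 * (?n * l))"
    have "a $ i - 5 * ?n * l \<le> x $ i \<and> x $ i \<le> a $ i - 5 * ?n * l + 10 * ?n * l" for i
    proof -
      have *: "\<bar>x $ i - a $ i\<bar> \<le> 5 * ?n * l"
        using x component_le_norm_cart[of "x - a" i] by (auto simp: dist_norm norm_minus_commute)
      show ?thesis using abs_le_D1[OF *] abs_le_D2[OF *] by (simp add: algebra_simps)
    qed
    then show "x \<in> cube (\<chi> i. a $ i - 5 * ?n * l) (10 * ?n * l)" by (simp add: mem_cube)
  qed
  have cov: "{x. ennreal t < maximal f x} \<subseteq> (\<Union>p\<in>J. cball (fst p) (?n * snd p))"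
  proof
    fix x assume "x \<in> {x. ennreal t < maximal f x}"
    then obtain Q where Q: "Q \<in> cubes" "x \<in> Q" "ennreal t < average Q (\<lambda>y. \<bar>f y\<bar>)"
      by (auto simp: maximal_def less_SUP_iff)
    then obtain a l where "0 < l" "Q = cube a l" by (auto elim: cubesE)
    then have "(a, l) \<in> J" "x \<in> cball a (?n * l)" using Q sub[of a l] by (auto simp: J_def)
    then show "x \<in> (\<Union>p\<in>J. cball (fst p) (?n * snd p))" by force
  qed
  have rad: "0 < ?n * snd p \<and> ?n * snd p \<le> ?n * max 1 (c / t)" if "p \<in> J" for p :: "(real ^ 'n) \<times> real"
    using Jl[of "fst p" "snd p"] Jb[of "fst p" "snd p"] that by (auto intro!: mult_left_mono simp del: max_less_iff_conj)
  obtain C where C: "countable C" "C \<subseteq> J"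
      "pairwise (\<lambda>i j. disjnt (cball (fst i) (?n * snd i)) (cball (fst j) (?n * snd j))) C"
      "{x. ennreal t < maximal f x} \<subseteq> (\<Union>i\<in>C. cball (fst i) (5 * (?n * snd i)))"
    by (rule Vitali_covering_lemma_cballs[OF cov rad])
  let ?Q = "\<lambda>p. cube (fst p) (snd p)"
  have "emeasure lebesgue {x. ennreal t < maximal f x} \<le> emeasure lebesgue (\<Union>i\<in>C. cball (fst i) (5 * (?n * snd i)))"
    using C by (intro emeasure_mono) auto
  also have "\<dots> \<le> (\<integral>\<^sup>+ i. emeasure lebesgue (cball (fst i) (5 * (?n * snd i))) \<partial>count_space C)"
    using C by (intro emeasure_UN_le_nn_integral) auto
  also have "\<dots> \<le> (\<integral>\<^sup>+ i. ennreal ((10 * ?n) ^ ?n) * emeasure lebesgue (?Q i) \<partial>count_space C)"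
  proof (intro nn_integral_mono)
    fix i assume "i \<in> space (count_space C)"
    then have l: "0 < snd i" using C(2) Jl[of "fst i" "snd i"] by auto
    have "emeasure lebesgue (cball (fst i) (5 * (?n * snd i)))
        \<le> emeasure lebesgue (cube (\<chi> j. fst i $ j - 5 * ?n * snd i) (10 * ?n * snd i))"
      using sup by (intro emeasure_mono) auto
    also have "\<dots> = ennreal ((10 * ?n) ^ ?n) * emeasure lebesgue (?Q i)"
      using l by (simp add: emeasure_cube power_mult_distrib ennreal_mult[symmetric])
    finally show "emeasure lebesgue (cball (fst i) (5 * (?n * snd i)))
        \<le> ennreal ((10 * ?n) ^ ?n) * emeasure lebesgue (?Q i)" .
  qed
  also have "\<dots> = ennreal ((10 * ?n) ^ ?n) * (\<integral>\<^sup>+ i. emeasure lebesgue (?Q i) \<partial>count_space C)"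
    by (intro nn_integral_cmult) auto
  finally have "ennreal t * emeasure lebesgue {x. ennreal t < maximal f x}
      \<le> ennreal t * (ennreal ((10 * ?n) ^ ?n) * (\<integral>\<^sup>+ i. emeasure lebesgue (?Q i) \<partial>count_space C))"
    by (rule mult_left_mono) simp
  also have "\<dots> = ennreal ((10 * ?n) ^ ?n) * (\<integral>\<^sup>+ i. ennreal t * emeasure lebesgue (?Q i) \<partial>count_space C)"
    by (subst nn_integral_cmult) (auto simp: mult_ac)
  also have "\<dots> \<le> ennreal ((10 * ?n) ^ ?n) * (\<integral>\<^sup>+ i. (\<integral>\<^sup>+ x \<in> ?Q i. ennreal \<bar>f x\<bar> \<partial>lebesgue) \<partial>count_space C)"
    using C(2) J by (intro mult_left_mono nn_integral_mono) auto
  also have "\<dots> \<le> ennreal ((10 * ?n) ^ ?n) * (\<integral>\<^sup>+ x. ennreal \<bar>f x\<bar> \<partial>lebesgue)"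
  proof (intro mult_left_mono nn_integral_disjoint_le)
    \<comment> \<open>The cubes inherit disjointness from the undilated balls that contain
      them.\<close>
    show "disjoint_family_on ?Q C"
      using C(3) sub unfolding disjoint_family_on_def pairwise_def disjnt_def
      by (metis (no_types, lifting) Int_mono subset_empty)
  qed (use C in auto)
  finally show ?thesis .
qed

section \<open>Lebesgue differentiation\<close>

lemma nn_integral_cube:
  fixes a :: "real ^ 'n"
  assumes "0 < l"
  shows "(\<integral>\<^sup>+ x \<in> cube a l. ennreal (f x) \<partial>lebesgue) = average (cube a l) f * emeasure lebesgue (cube a l)"
proof -
  have "ennreal (1 / l ^ CARD('n)) * ennreal (l ^ CARD('n)) = 1"
    using assms by (simp add: ennreal_mult[symmetric])
  then show ?thesis
    using assms by (simp add: average_cube emeasure_cube mult.assoc)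
qed

text \<open>Cover the set by the dyadic cubes meeting it inside an open superset of almost the same measure: the
  average of $|f|$ over each of them is at most $a$.\<close>

lemma maximal_less_null:
  fixes f :: "real ^ 'n \<Rightarrow> real"
  assumes f [measurable]: "f \<in> borel_measurable lebesgue" and ab: "0 \<le> a" "a < b" and N: "0 < N"
    and E: "E = {x \<in> cube (\<chi> i. - N) (2 * N). maximal f x \<le> ennreal a \<and> b < \<bar>f x\<bar>}"
  shows "emeasure lebesgue E = 0"
proof -
  have Em [measurable]: "E \<in> sets lebesgue"
  proof -
    have "E = {x \<in> space lebesgue. maximal f x \<le> ennreal a \<and> b < \<bar>f x\<bar>} \<inter> cube (\<chi> i. - N) (2 * N)"
      by (auto simp: E)
    then show ?thesis by simp
  qed
  have sub: "E \<subseteq> cube (\<chi> i. - N) (2 * N)" by (auto simp: E)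
  have "emeasure lebesgue E \<le> emeasure lebesgue (cube (\<chi> i. - N :: real ^ 'n) (2 * N))"
    by (rule emeasure_mono[OF sub]) simp
  also have "\<dots> < \<infinity>" using N by (simp add: emeasure_cube)
  finally obtain m where m: "0 \<le> m" "emeasure lebesgue E = ennreal m"
    by (cases "emeasure lebesgue E") auto
  \<comment> \<open>On E the function exceeds b, while its integral over the covering cubes is at
    most a times their total measure. As e tends to 0 this contradicts a < b unless m = 0.\<close>
  have le: "b * m \<le> a * (m + e)" if e: "0 < e" for e
  proof -
    obtain T where T: "open T" "E \<subseteq> T" "emeasure lebesgue (T - E) < ennreal e" "T - E \<in> lmeasurable"
      using sets_lebesgue_outer_open[OF Em e] by metis
    \<comment> \<open>The covering cubes are tagged by points of E, a subset of T, so this gauge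
      forces them into T; the value \<open>UNIV\<close> only completes the gauge outside T.\<close>
    define g where "g x = (if x \<in> T then T else UNIV)" for x
    have g: "gauge g" using T(1) by (auto simp: gauge_def g_def)
    define lo hi where "lo = (\<chi> i. - N :: real ^ 'n)" and "hi = (\<chi> i. lo $ i + 2 * N)"
    have lohi: "hi $ i - lo $ i = 2 * N" for i by (simp add: hi_def)
    have "box lo hi \<noteq> {}" using N by (auto simp: interval_eq_empty_cart lo_def hi_def not_le)
    moreover have "E \<subseteq> cbox lo hi" using sub by (simp add: cube_def lo_def hi_def)
    ultimately obtain D where D: "countable D"
      "\<And>K. K \<in> D \<Longrightarrow> interior K \<noteq> {} \<and> (\<exists>c d. K = cbox c d)"
      "pairwise (\<lambda>A B. interior A \<inter> interior B = {}) D"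
      "\<And>K. K \<in> D \<Longrightarrow> \<exists>x \<in> E \<inter> K. K \<subseteq> g x"
      "\<And>u v. cbox u v \<in> D \<Longrightarrow> \<exists>n. \<forall>i \<in> Basis. v \<bullet> i - u \<bullet> i = (hi \<bullet> i - lo \<bullet> i) / 2^n"
      "E \<subseteq> \<Union>D"
      using covering_lemma[OF _ _ g] by metis
    have cube: "\<exists>c l. 0 < l \<and> K = cube c l" if KD: "K \<in> D" for K
    proof -
      obtain c d where K: "K = cbox c d" using D(2)[OF KD] by blast
      then obtain n where n: "\<And>i. i \<in> Basis \<Longrightarrow> d \<bullet> i - c \<bullet> i = (hi \<bullet> i - lo \<bullet> i) / 2^n"
        using D(5) KD by blast
      \<comment> \<open>All sides of the initial box equal 2N, so its dyadic pieces are again cubes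
        and compete in the maximal function.\<close>
      have "d $ i - c $ i = 2 * N / 2 ^ n" for i
        using n[of "axis i 1"] lohi[of i] by (simp add: cart_eq_inner_axis axis_in_Basis_iff)
      then have "d = (\<chi> i. c $ i + 2 * N / 2 ^ n)" by (simp add: vec_eq_iff algebra_simps)
      then show ?thesis using N K by (intro exI[of _ c] exI[of _ "2 * N / 2 ^ n"]) (auto simp: cube_def)
    qed
    have Dm: "K \<in> sets lebesgue" if "K \<in> D" for K using cube[OF that] by auto
    have DT: "K \<subseteq> T" if "K \<in> D" for K
      using D(4)[OF that] T(2) by (auto simp: g_def split: if_splits)
    \<comment> \<open>Only the interiors are disjoint; replacing cubes by interiors costs no measure
      and allows their measures to be added.\<close>
    have int: "emeasure lebesgue (interior K) = emeasure lebesgue K" if "K \<in> D" for K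
      using D(2)[OF that] by (auto simp: interior_cbox emeasure_completion emeasure_lborel_box_eq emeasure_lborel_cbox_eq)
    have Df: "(\<integral>\<^sup>+ x \<in> K. ennreal \<bar>f x\<bar> \<partial>lebesgue) \<le> ennreal a * emeasure lebesgue K" if KD: "K \<in> D" for K
    proof -
      obtain c l where l: "0 < l" "K = cube c l" using cube[OF KD] by blast
      obtain x where x: "x \<in> E" "x \<in> K" using D(4)[OF KD] by blast
      have "average K (\<lambda>x. \<bar>f x\<bar>) \<le> maximal f x"
        using l x by (intro average_le_maximal) (auto simp: cube_in_cubes)
      also have "\<dots> \<le> ennreal a" using x by (simp add: E)
      finally show ?thesis using l by (simp add: nn_integral_cube mult_right_mono)
    qed
    have [measurable]: "\<Union>D \<in> sets lebesgue" using D(1) Dm by (intro sets.countable_Union) auto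
    have "ennreal b * emeasure lebesgue E = (\<integral>\<^sup>+ x \<in> E. ennreal b \<partial>lebesgue)"
      by (simp add: nn_integral_cmult_indicator)
    also have "\<dots> \<le> (\<integral>\<^sup>+ x \<in> \<Union>D. ennreal \<bar>f x\<bar> \<partial>lebesgue)"
      using D(6) by (intro nn_integral_mono) (auto simp: E intro!: ennreal_leI less_imp_le split: split_indicator)
    also have "\<dots> = emeasure (density lebesgue (\<lambda>x. ennreal \<bar>f x\<bar>)) (\<Union>K\<in>D. K)"
      by (simp add: emeasure_density)
    also have "\<dots> \<le> (\<integral>\<^sup>+ K. emeasure (density lebesgue (\<lambda>x. ennreal \<bar>f x\<bar>)) K \<partial>count_space D)"
      using D(1) Dm by (intro emeasure_UN_le_nn_integral) auto
    also have "\<dots> \<le> (\<integral>\<^sup>+ K. ennreal a * emeasure lebesgue (interior K) \<partial>count_space D)"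
      using Df Dm by (intro nn_integral_mono) (auto simp: emeasure_density int)
    also have "\<dots> = ennreal a * (\<integral>\<^sup>+ K. emeasure lebesgue (interior K) \<partial>count_space D)"
      by (intro nn_integral_cmult) auto
    also have "(\<integral>\<^sup>+ K. emeasure lebesgue (interior K) \<partial>count_space D) = emeasure lebesgue (\<Union>K\<in>D. interior K)"
      using D(1,3) by (intro emeasure_UN_countable[symmetric])
        (auto simp: disjoint_family_on_def pairwise_def)
    also have "emeasure lebesgue (\<Union>K\<in>D. interior K) \<le> emeasure lebesgue T"
    proof (rule emeasure_mono)
      show "(\<Union>K\<in>D. interior K) \<subseteq> T" using DT interior_subset by blast
      show "T \<in> sets lebesgue" using T(1) by (simp add: borel_open)
    qed
    also have "emeasure lebesgue T = emeasure lebesgue E + emeasure lebesgue (T - E)"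
      using T by (subst plus_emeasure) (auto simp: Un_absorb1 fmeasurableD)
    also have "\<dots> \<le> ennreal (m + e)"
      using T(3) m(1) e by (subst ennreal_plus) (auto simp: m(2) intro: add_left_mono)
    finally have "ennreal b * ennreal m \<le> ennreal a * ennreal (m + e)"
      by (simp add: m(2) mult_left_mono)
    then have "ennreal (b * m) \<le> ennreal (a * (m + e))"
      using ab m(1) e by (simp add: ennreal_mult del: ennreal_plus)
    then show ?thesis using ab m(1) e by simp
  qed
  have "m = 0"
  proof (rule ccontr)
    assume "m \<noteq> 0"
    then have m0: "0 < m" using m by simp
    \<comment> \<open>Chosen so that (a + 1) e is half of (b - a) m; dividing by a + 1 instead of a
      covers a = 0.\<close>
    define e where "e = (b - a) * m / 2 / (a + 1)"
    have "0 < e" using m0 ab by (simp add: e_def)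
    have "a * e < (b - a) * m"
    proof -
      have "(a + 1) * e = (b - a) * m / 2"
        using ab unfolding e_def by (subst times_divide_eq_right, subst nonzero_mult_div_cancel_left) auto
      moreover have "0 < (b - a) * m" using m0 ab by simp
      ultimately show ?thesis using \<open>0 < e\<close> by (simp add: algebra_simps)
    qed
    with le[OF \<open>0 < e\<close>] show False by (simp add: algebra_simps)
  qed
  then show ?thesis using m by simp
qed

text \<open>At an exceptional point two rationals a < b fit strictly between the maximal function
  and |f|, and the point lies in some cube of integer half-side. The exceptional set is thus a
  countable union of the null sets of \<open>maximal_less_null\<close>.\<close>

lemma AE_le_maximal:
  fixes f :: "real ^ 'n \<Rightarrow> real"
  assumes f [measurable]: "f \<in> borel_measurable lebesgue"
  shows "AE x in lebesgue. ennreal \<bar>f x\<bar> \<le> maximal f x"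
proof -
  define E where "E a b k = {x \<in> cube (\<chi> i. - real (Suc k)) (2 * real (Suc k)).
      maximal f x \<le> ennreal a \<and> b < \<bar>f x\<bar>}" for a b k
  have "AE x in lebesgue. x \<notin> E (of_rat a) (of_rat b) k" if "0 \<le> a" "a < b" for a b :: rat and k
  proof (rule AE_not_in)
    have "E (of_rat a) (of_rat b) k = {x \<in> space lebesgue. maximal f x \<le> ennreal (of_rat a) \<and> of_rat b < \<bar>f x\<bar>}
        \<inter> cube (\<chi> i. - real (Suc k)) (2 * real (Suc k))"
      by (auto simp: E_def)
    then have "E (of_rat a) (of_rat b) k \<in> sets lebesgue" by simp
    moreover have "emeasure lebesgue (E (of_rat a) (of_rat b) k) = 0"
      using that by (intro maximal_less_null[OF f _ _ _ E_def]) (auto simp: of_rat_less)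
    ultimately show "E (of_rat a) (of_rat b) k \<in> null_sets lebesgue" by auto
  qed
  then have "AE x in lebesgue. \<forall>a b k. 0 \<le> a \<longrightarrow> a < b \<longrightarrow> x \<notin> E (of_rat a) (of_rat b) k"
    by (subst AE_all_countable)+ auto
  then show ?thesis
  proof eventually_elim
    case (elim x)
    show ?case
    proof (rule ccontr)
      assume "\<not> ennreal \<bar>f x\<bar> \<le> maximal f x"
      then have lt: "maximal f x < ennreal \<bar>f x\<bar>" by simp
      then obtain r where r: "0 \<le> r" "maximal f x = ennreal r" by (cases "maximal f x") auto
      have "r < \<bar>f x\<bar>" using lt r by (simp add: ennreal_less_iff)
      then obtain a where a: "r < of_rat a" "of_rat a < \<bar>f x\<bar>" using of_rat_dense by blast
      then obtain b where b: "of_rat a < (of_rat b :: real)" "of_rat b < \<bar>f x\<bar>" using of_rat_dense by blast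
      obtain k where "norm x \<le> real k" using real_arch_simple by blast
      then have "\<bar>x $ i\<bar> \<le> real (Suc k)" for i using component_le_norm_cart[of x i] by simp
      then have "x \<in> cube (\<chi> i. - real (Suc k)) (2 * real (Suc k))"
        by (auto simp: mem_cube abs_le_iff) (smt (verit))+
      then have "x \<in> E (of_rat a) (of_rat b) k"
        using a b r by (auto simp: E_def intro!: ennreal_leI)
      moreover have "0 \<le> a" "a < b"
        using a(1) b(1) r(1) by (auto simp: of_rat_less) (metis less_eq_real_def linorder_not_less of_rat_less_0_iff order_less_trans)
      ultimately show False using elim by blast
    qed
  qed
qed

section \<open>The Coifman--Rochberg theorem\<close>

lemma epowr_ennreal [simp]: "0 \<le> r \<Longrightarrow> epowr (ennreal r) s = ennreal (r powr s)"
  by (simp add: epowr_def)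

lemma epowr_top [simp]: "epowr \<infinity> s = \<infinity>" "epowr top s = top"
  by (simp_all add: epowr_def)

lemma epowr_0 [simp]: "epowr 0 s = 0"
  by (simp add: epowr_def)

lemma epowr_mono:
  assumes "x \<le> y" "0 \<le> s" shows "epowr x s \<le> epowr y s"
proof (cases y)
  case (real r)
  with assms obtain q where "0 \<le> q" "x = ennreal q" by (cases x) (auto simp: top_unique)
  then show ?thesis using real assms by (auto intro!: ennreal_leI powr_mono2)
qed simp

lemma epowr_measurable [measurable]: "(\<lambda>x. epowr x s) \<in> borel_measurable borel"
  unfolding epowr_def by measurable

lemma epowr_eq_top_iff [simp]: "epowr x s = top \<longleftrightarrow> x = top"
  by (simp add: epowr_def)

lemma epowr_eq_0_iff [simp]: "epowr x s = 0 \<longleftrightarrow> x = 0"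
  by (cases x) (auto simp: epowr_def ennreal_eq_0_iff dest: antisym)

lemma term_le_suminf_ennreal: "f k \<le> (\<Sum>k. f k :: ennreal)"
  using sum_le_suminf[of f "{k}"] by simp

text \<open>A discrete layer-cake bound. If h lies between 2^k s and 2^(k+1) s, the k-th term alone
  dominates; if h is infinite, all terms are active and unbounded.\<close>

lemma epowr_le_dyadic_sum:
  assumes s: "0 < s" and \<mu>: "0 < \<mu>"
  shows "epowr h \<mu> \<le> ennreal (s powr \<mu>)
    + (\<Sum>k. ennreal ((2 ^ Suc k * s) powr \<mu>) * (if ennreal (2 ^ k * s) < h then 1 else 0))"
    (is "_ \<le> _ + suminf ?F")
proof (cases h)
  case (real r)
  show ?thesis
  proof (cases "r \<le> s")
    case True
    then have "epowr h \<mu> \<le> ennreal (s powr \<mu>)"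
      using real \<mu> by (auto intro!: ennreal_leI powr_mono2)
    then show ?thesis by (rule order_trans) simp
  next
    case False
    obtain j where "r / s < 2 ^ j" using real_arch_pow[of 2 "r / s"] by auto
    then have ex: "r \<le> 2 ^ Suc j * s" using s real by (simp add: divide_simps)
    \<comment> \<open>Minimality gives the matching lower bound 2^k s < r; for k = 0 this is the
      case assumption s < r.\<close>
    define k where "k = (LEAST k. r \<le> 2 ^ Suc k * s)"
    have k: "r \<le> 2 ^ Suc k * s" unfolding k_def by (rule LeastI[of _ j]) (use ex in simp)
    have k': "2 ^ k * s < r"
    proof (cases k)
      case 0 then show ?thesis using False by simp
    next
      case (Suc i)
      then have "\<not> r \<le> 2 ^ Suc i * s"
        using not_less_Least[of i "\<lambda>k. r \<le> 2 ^ Suc k * s"] unfolding k_def[symmetric] by simp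
      then show ?thesis using Suc by simp
    qed
    then have "epowr h \<mu> \<le> ?F k"
      using k real s \<mu> by (auto intro!: ennreal_leI powr_mono2 simp: ennreal_less_iff)
    also have "\<dots> \<le> suminf ?F" by (rule term_le_suminf_ennreal)
    finally show ?thesis by (rule order_trans) simp
  qed
next
  case top
  have "suminf ?F = \<infinity>"
  proof (rule ccontr)
    assume "suminf ?F \<noteq> \<infinity>"
    then obtain r where r: "0 \<le> r" "suminf ?F = ennreal r" by (cases "suminf ?F") auto
    \<comment> \<open>With this j the j-th term is at least r + 1, more than the supposed value r of
      the whole sum.\<close>
    obtain j where j: "(r + 1) powr (1 / \<mu>) / s < 2 ^ j" using real_arch_pow[of 2] by auto
    have "(r + 1) powr (1 / \<mu>) \<le> 2 ^ Suc j * s"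
    proof -
      have "(r + 1) powr (1 / \<mu>) < 2 ^ j * s" using j s by (simp add: pos_divide_less_eq)
      also have "\<dots> \<le> 2 ^ Suc j * s" using s by simp
      finally show ?thesis by simp
    qed
    then have "((r + 1) powr (1 / \<mu>)) powr \<mu> \<le> (2 ^ Suc j * s) powr \<mu>"
      using \<mu> by (intro powr_mono2) auto
    then have "r + 1 \<le> (2 ^ Suc j * s) powr \<mu>" using r(1) \<mu> by (simp add: powr_powr)
    then have "ennreal (r + 1) \<le> ?F j" using top by (auto intro!: ennreal_leI)
    also have "\<dots> \<le> ennreal r" unfolding r(2)[symmetric] by (rule term_le_suminf_ennreal)
    finally show False using r(1) by simp
  qed
  then show ?thesis by simp
qed

text \<open>Values up to s contribute at most s^\<mu> per unit of measure. On the level 2^k s the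
  weak bound gives (2^(k+1) s)^\<mu> B / 2^k = B 2^\<mu> s^\<mu> q^k with q = 2^(\<mu>-1). Here
  \<mu> < 1 makes q < 1, and summing the series produces the denominator 1 - q.\<close>

lemma kolmogorov_inequality:
  assumes [measurable]: "h \<in> borel_measurable M" "X \<in> sets M"
    and s: "0 < s" and \<mu>: "0 < \<mu>" "\<mu> < 1" and B: "0 \<le> B"
    and weak: "\<And>t. s \<le> t \<Longrightarrow> ennreal t * emeasure M {x \<in> X. ennreal t < h x} \<le> ennreal (B * s) * emeasure M X"
  shows "(\<integral>\<^sup>+ x \<in> X. epowr (h x) \<mu> \<partial>M)
    \<le> ennreal ((1 + B * 2 powr \<mu> / (1 - 2 powr (\<mu> - 1))) * s powr \<mu>) * emeasure M X"
proof -
  define q :: real where "q = 2 powr (\<mu> - 1)"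
  have q: "0 < q" "q < 1" using \<mu> powr_less_mono[of "\<mu> - 1" 0 2] by (auto simp: q_def)
  define E where "E k = {x \<in> X. ennreal (2 ^ k * s) < h x}" for k :: nat
  define c where "c k = (2 ^ Suc k * s) powr \<mu>" for k :: nat
  have E [measurable]: "E k \<in> sets M" for k
  proof -
    have "E k = {x \<in> space M. ennreal (2 ^ k * s) < h x} \<inter> X"
      using sets.sets_into_space[of X M] by (auto simp: E_def)
    then show ?thesis by simp
  qed
  have dyad: "ennreal (c k) * emeasure M (E k) \<le> ennreal (s powr \<mu> * (B * 2 powr \<mu>) * q ^ k) * emeasure M X" for k
  proof -
    define t where "t = 2 ^ k * s"
    have t: "s \<le> t" "0 < t" using s by (auto simp: t_def)
    have qk: "q ^ k = (2 ^ k) powr \<mu> / 2 ^ k"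
    proof -
      have "((2::real) ^ k) powr \<mu> = (2 powr \<mu>) ^ k" by (induction k) (auto simp: powr_mult)
      then show ?thesis by (simp add: q_def powr_diff power_divide)
    qed
    have eq: "c k = s powr \<mu> * 2 powr \<mu> * q ^ k / s * t"
      using s by (simp add: c_def t_def powr_mult qk)
    have "ennreal (c k) * emeasure M (E k)
        = ennreal (s powr \<mu> * 2 powr \<mu> * q ^ k / s) * (ennreal t * emeasure M (E k))"
      unfolding eq using q s t by (subst ennreal_mult) (auto simp: mult.assoc)
    also have "\<dots> \<le> ennreal (s powr \<mu> * 2 powr \<mu> * q ^ k / s) * (ennreal (B * s) * emeasure M X)"
      using weak[OF t(1)] by (intro mult_left_mono) (auto simp: E_def t_def)
    also have "\<dots> = ennreal (s powr \<mu> * 2 powr \<mu> * q ^ k / s * (B * s)) * emeasure M X"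
      using q s B by (subst ennreal_mult) (auto simp: mult.assoc)
    also have "s powr \<mu> * 2 powr \<mu> * q ^ k / s * (B * s) = s powr \<mu> * (B * 2 powr \<mu>) * q ^ k"
      using s by simp
    finally show ?thesis .
  qed
  have "(\<integral>\<^sup>+ x \<in> X. epowr (h x) \<mu> \<partial>M)
      \<le> (\<integral>\<^sup>+ x. ennreal (s powr \<mu>) * indicator X x + (\<Sum>k. ennreal (c k) * indicator (E k) x) \<partial>M)"
  proof (intro nn_integral_mono)
    fix x
    show "epowr (h x) \<mu> * indicator X x \<le> ennreal (s powr \<mu>) * indicator X x + (\<Sum>k. ennreal (c k) * indicator (E k) x)"
    proof (cases "x \<in> X")
      case True
      then have "indicator (E k) x = (if ennreal (2 ^ k * s) < h x then 1 else 0 :: ennreal)" for k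
        by (simp add: E_def indicator_def)
      then show ?thesis using epowr_le_dyadic_sum[OF s \<mu>(1), of "h x"] True by (simp add: c_def)
    qed simp
  qed
  also have "\<dots> = ennreal (s powr \<mu>) * emeasure M X + (\<Sum>k. ennreal (c k) * emeasure M (E k))"
    by (subst nn_integral_add) (auto simp: nn_integral_suminf nn_integral_cmult_indicator)
  also have "\<dots> \<le> ennreal (s powr \<mu>) * emeasure M X
      + (\<Sum>k. ennreal (s powr \<mu> * (B * 2 powr \<mu>) * q ^ k) * emeasure M X)"
    by (intro add_left_mono suminf_le dyad) auto
  also have "\<dots> = ennreal (s powr \<mu>) * emeasure M X
      + (\<Sum>k. ennreal (s powr \<mu> * (B * 2 powr \<mu>) * q ^ k)) * emeasure M X"
    by simp
  also have "(\<Sum>k. ennreal (s powr \<mu> * (B * 2 powr \<mu>) * q ^ k)) = ennreal (s powr \<mu> * (B * 2 powr \<mu>) * (1 / (1 - q)))"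
    using q B by (intro suminf_ennreal_eq sums_mult geometric_sums) auto
  also have "ennreal (s powr \<mu>) * emeasure M X + \<dots> * emeasure M X
      = ennreal (s powr \<mu> + s powr \<mu> * (B * 2 powr \<mu>) * (1 / (1 - q))) * emeasure M X"
    using q B by (subst ennreal_plus) (auto simp: distrib_right)
  also have "s powr \<mu> + s powr \<mu> * (B * 2 powr \<mu>) * (1 / (1 - q))
      = (1 + B * 2 powr \<mu> / (1 - q)) * s powr \<mu>"
    by (simp add: distrib_right)
  finally show ?thesis unfolding q_def .
qed

text \<open>A cube through $z$ that leaves the threefold dilation of the cube around $x$ and $z$ has side larger than $l$, so its own threefold
  dilation contains $x$.\<close>

lemma maximal_localize:
  fixes f :: "real ^ 'n \<Rightarrow> real"
  assumes l: "0 < l" and x: "x \<in> cube a l" and z: "z \<in> cube a l"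
    and t: "ennreal (3 ^ CARD('n)) * maximal f x \<le> t" "t < maximal f z"
  shows "t < maximal (\<lambda>y. f y * indicator (cube (\<chi> i. a $ i - l) (3 * l)) y) z"
proof -
  define R where "R = cube (\<chi> i. a $ i - l) (3 * l)"
  obtain P where P: "P \<in> cubes" "z \<in> P" "t < average P (\<lambda>y. \<bar>f y\<bar>)"
    using t(2) by (auto simp: maximal_def less_SUP_iff)
  then obtain b k where k: "0 < k" "P = cube b k" by (auto elim: cubesE)
  have "P \<subseteq> R"
  proof (rule ccontr)
    assume "\<not> P \<subseteq> R"
    then obtain p where p: "p \<in> P" "p \<notin> R" by blast
    then obtain j where "\<not> (a $ j - l \<le> p $ j \<and> p $ j \<le> a $ j - l + 3 * l)"
      by (auto simp: R_def mem_cube)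
    then have j: "p $ j < a $ j - l \<or> a $ j + 2 * l < p $ j" by linarith
    have "b $ j \<le> p $ j" "p $ j \<le> b $ j + k" "b $ j \<le> z $ j" "z $ j \<le> b $ j + k"
      "a $ j \<le> z $ j" "z $ j \<le> a $ j + l"
      using p(1) P(2) z k by (auto simp: mem_cube)
    then have lk: "l < k" using j by linarith
    have "x \<in> cube (\<chi> i. b $ i - k) (3 * k)"
    proof -
      have "b $ i - k \<le> x $ i \<and> x $ i \<le> b $ i - k + 3 * k" for i
      proof -
        have "b $ i \<le> z $ i" "z $ i \<le> b $ i + k" "a $ i \<le> z $ i" "z $ i \<le> a $ i + l"
          "a $ i \<le> x $ i" "x $ i \<le> a $ i + l"
          using P(2) z x k by (auto simp: mem_cube)
        then show ?thesis using lk by linarith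
      qed
      then show ?thesis by (simp add: mem_cube)
    qed
    then have "average (cube (\<chi> i. b $ i - k) (3 * k)) (\<lambda>y. \<bar>f y\<bar>) \<le> maximal f x"
      using k by (intro average_le_maximal) (auto simp: cube_in_cubes)
    moreover have "cube b k \<subseteq> cube (\<chi> i. b $ i - k) (3 * k)"
    proof
      fix y assume y: "y \<in> cube b k"
      have "b $ i - k \<le> y $ i \<and> y $ i \<le> b $ i - k + 3 * k" for i
        using y[unfolded mem_cube, rule_format, of i] k(1) by simp
      then show "y \<in> cube (\<chi> i. b $ i - k) (3 * k)" by (simp add: mem_cube)
    qed
    then have "average P (\<lambda>y. \<bar>f y\<bar>)
        \<le> ennreal (3 ^ CARD('n)) * average (cube (\<chi> i. b $ i - k) (3 * k)) (\<lambda>y. \<bar>f y\<bar>)"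
      unfolding k(2) using k by (intro average_cube_subset) auto
    ultimately have "average P (\<lambda>y. \<bar>f y\<bar>) \<le> ennreal (3 ^ CARD('n)) * maximal f x"
      by (meson mult_left_mono order_trans zero_le)
    then show False using t(1) P(3) by simp
  qed
  \<comment> \<open>Inside the dilated cube, cutting off \<open>f\<close> does not change its
    average over P.\<close>
  then have "average P (\<lambda>y. \<bar>f y\<bar>) = average P (\<lambda>y. \<bar>f y * indicator R y\<bar>)"
    unfolding average_def
    by (intro arg_cong2[where f = "(/)"] nn_integral_cong refl) (auto split: split_indicator)
  then show ?thesis
    using P average_le_maximal[of P z "\<lambda>y. f y * indicator R y"] by (simp add: R_def)
qed

text \<open>Above the level 3^n M f(x), the maximal function on Q sees only the part of f inside the
  threefold cube, by \<open>maximal_localize\<close>. The weak type bound for this local part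
  supplies the hypothesis of Kolmogorov's inequality. The constant depends only on n and
  \<mu>.\<close>

lemma coifman_rochberg:
  assumes \<mu>: "0 < \<mu>" "\<mu> < 1"
  obtains C where "0 < C" "\<And>(f :: real ^ 'n \<Rightarrow> real) Q x. f \<in> borel_measurable lebesgue \<Longrightarrow> Q \<in> cubes \<Longrightarrow> x \<in> Q \<Longrightarrow>
    0 < maximal f x \<Longrightarrow>
    (\<integral>\<^sup>+ z \<in> Q. epowr (maximal f z) \<mu> \<partial>lebesgue) \<le> ennreal C * epowr (maximal f x) \<mu> * emeasure lebesgue Q"
proof -
  let ?n = "CARD('n)"
  define K :: real where "K = (10 * ?n) ^ ?n"
  have K: "0 < K" by (simp add: K_def)
  define c where "c = 1 + K * 2 powr \<mu> / (1 - 2 powr (\<mu> - 1))"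
  have "2 powr (\<mu> - 1) < (1::real)" using \<mu> powr_less_mono[of "\<mu> - 1" 0 2] by auto
  then have c: "0 < c" using K by (auto simp: c_def intro!: add_pos_nonneg)
  define C where "C = c * (3 ^ ?n) powr \<mu>"
  have C: "0 < C" using c by (simp add: C_def)
  show ?thesis
  proof (rule that[OF C])
    fix f :: "real ^ 'n \<Rightarrow> real" and Q x
    assume f [measurable]: "f \<in> borel_measurable lebesgue" and Q: "Q \<in> cubes" and x: "x \<in> Q" and pos: "0 < maximal f x"
    obtain a l where l: "0 < l" and Qal: "Q = cube a l" using Q by (rule cubesE)
    show "(\<integral>\<^sup>+ z \<in> Q. epowr (maximal f z) \<mu> \<partial>lebesgue) \<le> ennreal C * epowr (maximal f x) \<mu> * emeasure lebesgue Q"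
    proof (cases "maximal f x")
      case top
      then show ?thesis
        using C l by (simp add: Qal emeasure_cube ennreal_mult_top ennreal_top_mult)
    next
      case (real m)
      then have m: "0 < m" using pos by auto
      \<comment> \<open>This value plays two roles: it is the localization threshold, and s |Q| =
        |3Q| M f(x) bounds the integral of the local part.\<close>
      define s where "s = 3 ^ ?n * m"
      have s: "0 < s" using m by (simp add: s_def)
      define R where "R = cube (\<chi> i. a $ i - l) (3 * l)"
      define f1 where "f1 = (\<lambda>y. f y * indicator R y)"
      have [measurable]: "R \<in> sets lebesgue" by (simp add: R_def)
      have f1 [measurable]: "f1 \<in> borel_measurable lebesgue" unfolding f1_def by measurable
      have QR: "Q \<subseteq> R"
      proof
        fix y assume y: "y \<in> Q"
        have "a $ i - l \<le> y $ i \<and> y $ i \<le> a $ i - l + 3 * l" for i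
          using y[unfolded Qal mem_cube, rule_format, of i] l by simp
        then show "y \<in> R" by (simp add: R_def mem_cube)
      qed
      have "(\<integral>\<^sup>+ y. ennreal \<bar>f1 y\<bar> \<partial>lebesgue) = (\<integral>\<^sup>+ y \<in> R. ennreal \<bar>f y\<bar> \<partial>lebesgue)"
        by (intro nn_integral_cong) (auto simp: f1_def split: split_indicator)
      also have "\<dots> = average R (\<lambda>y. \<bar>f y\<bar>) * emeasure lebesgue R"
        using l by (simp add: R_def nn_integral_cube)
      also have "\<dots> \<le> ennreal m * emeasure lebesgue R"
        using l x QR real average_le_maximal[of R x f] by (intro mult_right_mono) (auto simp: R_def cube_in_cubes)
      also have "\<dots> = ennreal s * emeasure lebesgue Q"
        using l m by (simp add: R_def Qal emeasure_cube s_def power_mult_distrib ennreal_mult[symmetric] mult_ac)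
      finally have f1_le: "(\<integral>\<^sup>+ y. ennreal \<bar>f1 y\<bar> \<partial>lebesgue) \<le> ennreal s * emeasure lebesgue Q" .
      have "(\<integral>\<^sup>+ z \<in> Q. epowr (maximal f z) \<mu> \<partial>lebesgue) \<le> ennreal (c * s powr \<mu>) * emeasure lebesgue Q"
        unfolding c_def
      proof (rule kolmogorov_inequality)
        fix t assume t: "s \<le> t"
        have "{z \<in> Q. ennreal t < maximal f z} \<subseteq> {z. ennreal t < maximal f1 z}"
        proof
          fix z assume z: "z \<in> {z \<in> Q. ennreal t < maximal f z}"
          have "ennreal (3 ^ ?n) * maximal f x \<le> ennreal t"
            using t m by (simp add: real ennreal_mult[symmetric] s_def ennreal_leI)
          then show "z \<in> {z. ennreal t < maximal f1 z}"
            using maximal_localize[OF l, of x a z f "ennreal t"] z x by (simp add: Qal f1_def R_def)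
        qed
        moreover have "{z. ennreal t < maximal f1 z} \<in> sets lebesgue"
          by (simp add: borel_open open_maximal_greater)
        ultimately have "ennreal t * emeasure lebesgue {z \<in> Q. ennreal t < maximal f z}
            \<le> ennreal t * emeasure lebesgue {z. ennreal t < maximal f1 z}"
          by (intro mult_left_mono emeasure_mono) auto
        also have "\<dots> \<le> ennreal K * (\<integral>\<^sup>+ y. ennreal \<bar>f1 y\<bar> \<partial>lebesgue)"
          using maximal_weak_type[OF f1, of t] s t by (simp add: K_def)
        also have "\<dots> \<le> ennreal K * (ennreal s * emeasure lebesgue Q)"
          by (intro mult_left_mono f1_le) simp
        also have "\<dots> = ennreal (K * s) * emeasure lebesgue Q"
          using K s by (simp add: ennreal_mult mult.assoc)
        finally show "ennreal t * emeasure lebesgue {z \<in> Q. ennreal t < maximal f z} \<le> ennreal (K * s) * emeasure lebesgue Q" .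
      qed (use s \<mu> K in \<open>auto simp: Qal\<close>)
      also have "ennreal (c * s powr \<mu>) = ennreal C * epowr (maximal f x) \<mu>"
        using c m by (simp add: real C_def s_def powr_mult ennreal_mult[symmetric] mult.assoc)
      finally show ?thesis .
    qed
  qed
qed

section \<open>Muckenhoupt weights\<close>

text \<open>Countably many cubes centred at \<open>x\<^sub>0\<close> exhaust the space. Considering
  only cubes through \<open>x\<^sub>0\<close> lets information about a maximal function at that one
  point spread almost everywhere.\<close>

lemma AE_if_AE_cubes:
  fixes x\<^sub>0 :: "real ^ 'n"
  assumes "\<And>Q. Q \<in> cubes \<Longrightarrow> x\<^sub>0 \<in> Q \<Longrightarrow> AE x in lebesgue. x \<in> Q \<longrightarrow> P x"
  shows "AE x in lebesgue. P x"
proof -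
  define Q where "Q k = cube (\<chi> i. x\<^sub>0 $ i - real (Suc k)) (2 * real (Suc k))" for k
  have "AE x in lebesgue. \<forall>k. x \<in> Q k \<longrightarrow> P x"
    unfolding AE_all_countable by (intro allI assms) (auto simp: Q_def cube_in_cubes mem_cube)
  then show ?thesis
  proof eventually_elim
    case (elim x)
    obtain k where k: "norm (x - x\<^sub>0) \<le> real k" using real_arch_simple by blast
    have "x\<^sub>0 $ i - real (Suc k) \<le> x $ i \<and> x $ i \<le> x\<^sub>0 $ i - real (Suc k) + 2 * real (Suc k)" for i
    proof -
      have *: "\<bar>x $ i - x\<^sub>0 $ i\<bar> \<le> real k" using k component_le_norm_cart[of "x - x\<^sub>0" i] by simp
      show ?thesis using abs_le_D1[OF *] abs_le_D2[OF *] by simp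
    qed
    then have "x \<in> Q k" by (simp add: Q_def mem_cube)
    then show ?case using elim by blast
  qed
qed

lemma emeasure_cubes:
  assumes "Q \<in> cubes"
  shows "0 < emeasure lebesgue Q" "emeasure lebesgue Q < \<infinity>" "Q \<in> sets lebesgue"
  using assms by (auto elim!: cubesE simp: emeasure_cube)

lemma AE_cube_ex:
  assumes Q: "Q \<in> cubes" and P: "AE x in lebesgue. x \<in> Q \<longrightarrow> P x"
  shows "\<exists>x\<in>Q. P x"
proof (rule ccontr)
  assume "\<not> (\<exists>x\<in>Q. P x)"
  then have nP: "\<And>x. x \<in> Q \<Longrightarrow> \<not> P x" by blast
  have "AE x in lebesgue. x \<notin> Q" using P by (rule eventually_mono) (use nP in blast)
  then have "emeasure lebesgue Q = 0"
    using emeasure_cubes[OF Q] by (subst (asm) AE_iff_measurable[where N = Q]) auto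
  then show False using emeasure_cubes[OF Q] by simp
qed

lemma nn_integral_cubes:
  assumes "Q \<in> cubes"
  shows "(\<integral>\<^sup>+ x \<in> Q. ennreal (f x) \<partial>lebesgue) = average Q f * emeasure lebesgue Q"
  using assms by (auto elim!: cubesE simp: nn_integral_cube)

lemma average_cubes_le:
  assumes "Q \<in> cubes" "(\<integral>\<^sup>+ x \<in> Q. ennreal (f x) \<partial>lebesgue) \<le> c * emeasure lebesgue Q"
  shows "average Q f \<le> c"
proof -
  have "average Q f * emeasure lebesgue Q \<le> c * emeasure lebesgue Q"
    using assms by (simp add: nn_integral_cubes)
  moreover obtain r where "0 < r" "emeasure lebesgue Q = ennreal r"
    using emeasure_cubes[OF assms(1)] by (cases "emeasure lebesgue Q") auto
  ultimately show ?thesis by (simp add: ennreal_mult_le_mult_iff mult.commute[of _ "ennreal r"])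
qed

lemma average_pos:
  assumes Q: "Q \<in> cubes" and [measurable]: "w \<in> borel_measurable lebesgue"
    and w: "AE x in lebesgue. x \<in> Q \<longrightarrow> 0 < w x"
  shows "0 < average Q w"
proof (rule ccontr)
  assume "\<not> 0 < average Q w"
  then have "(\<integral>\<^sup>+ x \<in> Q. ennreal (w x) \<partial>lebesgue) = 0" by (simp add: nn_integral_cubes[OF Q])
  then have "AE x in lebesgue. ennreal (w x) * indicator Q x = 0"
    using emeasure_cubes(3)[OF Q] by (subst (asm) nn_integral_0_iff_AE) auto
  with w have False: "AE x in lebesgue. x \<in> Q \<longrightarrow> False"
    by eventually_elim (auto simp: ennreal_eq_0_iff split: split_indicator_asm)
  from AE_cube_ex[OF Q False] show False by blast
qed

lemma average_le_cmult:
  assumes Q: "Q \<in> cubes" and [measurable]: "g \<in> borel_measurable lebesgue" and K: "0 \<le> K"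
    and le: "AE x in lebesgue. x \<in> Q \<longrightarrow> f x \<le> K * g x"
  shows "average Q f \<le> ennreal K * average Q g"
proof (rule average_cubes_le[OF Q])
  have [measurable]: "Q \<in> sets lebesgue" using emeasure_cubes[OF Q] by simp
  have "(\<integral>\<^sup>+ x \<in> Q. ennreal (f x) \<partial>lebesgue) \<le> (\<integral>\<^sup>+ x. ennreal K * (ennreal (g x) * indicator Q x) \<partial>lebesgue)"
    using le by (intro nn_integral_mono_AE, eventually_elim)
      (auto simp: ennreal_mult'[symmetric] K intro!: ennreal_leI split: split_indicator)
  also have "\<dots> = ennreal K * average Q g * emeasure lebesgue Q"
    by (subst nn_integral_cmult) (auto simp: nn_integral_cubes[OF Q] mult.assoc)
  finally show "(\<integral>\<^sup>+ x \<in> Q. ennreal (f x) \<partial>lebesgue) \<le> ennreal K * average Q g * emeasure lebesgue Q" .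
qed

lemma locally_integrableI:
  fixes w :: "real ^ 'n \<Rightarrow> real"
  assumes w [measurable]: "w \<in> borel_measurable lebesgue" and nn: "\<And>x. 0 \<le> w x"
    and fin: "\<And>Q. Q \<in> cubes \<Longrightarrow> average Q w < \<infinity>"
  shows "locally_integrable w"
  unfolding locally_integrable_def
proof (intro allI impI)
  fix K :: "(real ^ 'n) set" assume K: "compact K"
  then have [measurable]: "K \<in> sets lebesgue" by (simp add: borel_compact)
  obtain N where N: "0 < N" "\<And>x. x \<in> K \<Longrightarrow> norm x \<le> N"
    using compact_imp_bounded[OF K] unfolding bounded_pos by blast
  define Q where "Q = cube (\<chi> i. - N :: real ^ 'n) (2 * N)"
  have Q: "Q \<in> cubes" using N by (simp add: Q_def cube_in_cubes)
  have "K \<subseteq> Q"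
  proof
    fix x assume x: "x \<in> K"
    have "- N \<le> x $ i \<and> x $ i \<le> - N + 2 * N" for i
    proof -
      have *: "\<bar>x $ i\<bar> \<le> N" using N(2)[OF x] component_le_norm_cart[of x i] by simp
      show ?thesis using abs_le_D1[OF *] abs_le_D2[OF *] by simp
    qed
    then show "x \<in> Q" by (simp add: Q_def mem_cube)
  qed
  then have "(\<integral>\<^sup>+ x. ennreal (norm (indicator K x *\<^sub>R w x)) \<partial>lebesgue) \<le> (\<integral>\<^sup>+ x \<in> Q. ennreal (w x) \<partial>lebesgue)"
    using nn by (intro nn_integral_mono) (auto split: split_indicator)
  also have "\<dots> < \<infinity>"
    using fin[OF Q] emeasure_cubes[OF Q] by (simp add: nn_integral_cubes[OF Q] ennreal_mult_less_top)
  finally show "w absolutely_integrable_on K"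
    unfolding set_integrable_def integrable_iff_bounded by simp
qed

text \<open>At each point the truncations to balls about the origin are eventually equal to u, and
  each truncation is integrable.\<close>

lemma locally_integrable_measurable:
  fixes u :: "real ^ 'n \<Rightarrow> real"
  assumes "locally_integrable u" shows "u \<in> borel_measurable lebesgue"
proof (rule borel_measurable_LIMSEQ_real)
  show "(\<lambda>n. indicator (cball 0 (real n)) x *\<^sub>R u x) \<longlonglongrightarrow> u x" for x
  proof (rule tendsto_eventually)
    obtain N where "norm x \<le> real N" using real_arch_simple by blast
    then show "\<forall>\<^sub>F n in sequentially. indicator (cball 0 (real n)) x *\<^sub>R u x = u x"
      unfolding eventually_sequentially by (intro exI[of _ N]) (auto simp: indicator_def)
  qed
  show "(\<lambda>x. indicator (cball 0 (real n)) x *\<^sub>R u x) \<in> borel_measurable lebesgue" for n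
    using assms unfolding locally_integrable_def set_integrable_def
    by (intro borel_measurable_integrable) auto
qed

section \<open>A_1 weights and factorization\<close>

text \<open>The pointwise form of the A_1 condition, which the Coifman-Rochberg inequality delivers
  directly. Positivity is required only almost everywhere, because \<open>enn2real\<close> turns
  infinite values of a maximal function into 0.\<close>

definition A1_bound :: "real \<Rightarrow> (real ^ 'n \<Rightarrow> real) \<Rightarrow> bool" where
  "A1_bound c w \<longleftrightarrow> w \<in> borel_measurable lebesgue \<and> (\<forall>x. 0 \<le> w x) \<and> (AE x in lebesgue. 0 < w x) \<and>
    (\<forall>Q\<in>cubes. AE x in lebesgue. x \<in> Q \<longrightarrow> average Q w \<le> ennreal (c * w x))"

lemma A1_boundD:
  assumes "A1_bound c w"
  shows "w \<in> borel_measurable lebesgue" "0 \<le> w x" "AE x in lebesgue. 0 < w x"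
    "Q \<in> cubes \<Longrightarrow> AE x in lebesgue. x \<in> Q \<longrightarrow> average Q w \<le> ennreal (c * w x)"
  using assms by (auto simp: A1_bound_def)

text \<open>A single good point of Q already shows that the average is finite; the A_1 condition
  then reads as an essential lower bound for w on Q.\<close>

lemma A1_bound_average:
  assumes w: "A1_bound c w" and Q: "Q \<in> cubes" and c: "0 < c"
  obtains \<alpha> where "0 < \<alpha>" "average Q w = ennreal \<alpha>" "AE x in lebesgue. x \<in> Q \<longrightarrow> \<alpha> / c \<le> w x"
proof -
  obtain x where x: "average Q w \<le> ennreal (c * w x)"
    using AE_cube_ex[OF Q A1_boundD(4)[OF w Q]] by blast
  have pos: "0 < average Q w"
    using A1_boundD(3)[OF w] by (intro average_pos[OF Q A1_boundD(1)[OF w]]) auto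
  obtain \<alpha> where \<alpha>: "0 < \<alpha>" "average Q w = ennreal \<alpha>"
    using x pos by (cases "average Q w") (auto simp: top_unique)
  moreover have "AE x in lebesgue. x \<in> Q \<longrightarrow> \<alpha> / c \<le> w x"
    using A1_boundD(4)[OF w Q]
  proof eventually_elim
    case (elim x)
    show ?case
    proof
      assume "x \<in> Q"
      then have "ennreal \<alpha> \<le> ennreal (c * w x)" using elim \<alpha> by simp
      then have "\<alpha> \<le> c * w x" using A1_boundD(2)[OF w, of x] c by (simp add: ennreal_le_iff)
      then show "\<alpha> / c \<le> w x" using c by (simp add: field_simps)
    qed
  qed
  ultimately show ?thesis by (rule that)
qed

lemma weightI_A1:
  assumes w: "A1_bound c w" and c: "0 < c"
  shows "weight w"
proof -
  have "average Q w < \<infinity>" if "Q \<in> cubes" for Q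
    using A1_bound_average[OF w that c] by (metis ennreal_less_top infinity_ennreal_def)
  then show ?thesis
    using A1_boundD[OF w] by (auto simp: weight_def intro!: locally_integrableI)
qed

lemma A1_bound_Muckenhoupt_1:
  fixes w :: "real ^ 'n \<Rightarrow> real"
  assumes w: "A1_bound c w" and c: "0 < c"
  shows "w \<in> Muckenhoupt 1" "Muckenhoupt_const 1 w \<le> ennreal c"
proof -
  have [measurable]: "w \<in> borel_measurable lebesgue" using A1_boundD[OF w] by simp
  have "average Q w * esssup (restrict_space lebesgue Q) (\<lambda>x. ennreal (inverse (w x))) \<le> ennreal c"
    if Q: "Q \<in> cubes" for Q
  proof -
    obtain \<alpha> where \<alpha>: "0 < \<alpha>" "average Q w = ennreal \<alpha>" "AE x in lebesgue. x \<in> Q \<longrightarrow> \<alpha> / c \<le> w x"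
      using A1_bound_average[OF w Q c] by blast
    have "esssup (restrict_space lebesgue Q) (\<lambda>x. ennreal (inverse (w x))) \<le> ennreal (c / \<alpha>)"
    proof (rule esssup_I)
      show "(\<lambda>x. ennreal (inverse (w x))) \<in> borel_measurable (restrict_space lebesgue Q)"
        by (rule measurable_restrict_space1) simp
      have "AE x in lebesgue. x \<in> Q \<longrightarrow> ennreal (inverse (w x)) \<le> ennreal (c / \<alpha>)"
        using \<alpha>(3)
      proof eventually_elim
        case (elim x)
        show ?case
        proof
          assume "x \<in> Q"
          then have "\<alpha> / c \<le> w x" using elim by simp
          then have "inverse (w x) \<le> inverse (\<alpha> / c)" using \<alpha> c by (intro le_imp_inverse_le) auto
          then show "ennreal (inverse (w x)) \<le> ennreal (c / \<alpha>)" by (intro ennreal_leI) simp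
        qed
      qed
      then show "AE x in restrict_space lebesgue Q. ennreal (inverse (w x)) \<le> ennreal (c / \<alpha>)"
        using emeasure_cubes(3)[OF Q] by (subst AE_restrict_space_iff) auto
    qed
    then have "average Q w * esssup (restrict_space lebesgue Q) (\<lambda>x. ennreal (inverse (w x)))
        \<le> ennreal \<alpha> * ennreal (c / \<alpha>)"
      unfolding \<alpha>(2) by (intro mult_left_mono) auto
    also have "\<dots> = ennreal c" using \<alpha>(1) c by (simp add: ennreal_mult[symmetric])
    finally show ?thesis .
  qed
  then show le: "Muckenhoupt_const 1 w \<le> ennreal c"
    unfolding Muckenhoupt_const_def by (auto intro!: SUP_least)
  then show "w \<in> Muckenhoupt 1"
    using weightI_A1[OF w c] le_less_trans[OF le] by (simp add: Muckenhoupt_def)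
qed

text \<open>The easy half of the factorization of A_p weights. With \<alpha>, \<beta> the averages
  of u, v over Q, the lower bound v \<ge> \<beta>/d controls the average of w, and u \<ge>
  \<alpha>/c controls the average of the dual weight. In the product \<alpha> and \<beta> cancel,
  leaving c d^(p-1).\<close>

lemma A1_bound_Muckenhoupt:
  fixes u v :: "real ^ 'n \<Rightarrow> real"
  assumes p: "1 < p" and u: "A1_bound c u" and v: "A1_bound d v" and c: "0 < c" and d: "0 < d"
  defines "w \<equiv> \<lambda>x. u x * v x powr (1 - p)"
  shows "w \<in> Muckenhoupt p" "Muckenhoupt_const p w \<le> ennreal (c * d powr (p - 1))"
proof -
  have [measurable]: "u \<in> borel_measurable lebesgue" "v \<in> borel_measurable lebesgue"
    using A1_boundD[OF u] A1_boundD[OF v] by auto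
  have [measurable]: "w \<in> borel_measurable lebesgue" unfolding w_def by measurable
  have bounds: "average Q w < \<infinity>"
    "average Q w * epowr (average Q (\<lambda>x. w x powr (- 1 / (p - 1)))) (p - 1) \<le> ennreal (c * d powr (p - 1))"
    if Q: "Q \<in> cubes" for Q
  proof -
    obtain \<alpha> where \<alpha>: "0 < \<alpha>" "average Q u = ennreal \<alpha>" "AE x in lebesgue. x \<in> Q \<longrightarrow> \<alpha> / c \<le> u x"
      using A1_bound_average[OF u Q c] by blast
    obtain \<beta> where \<beta>: "0 < \<beta>" "average Q v = ennreal \<beta>" "AE x in lebesgue. x \<in> Q \<longrightarrow> \<beta> / d \<le> v x"
      using A1_bound_average[OF v Q d] by blast
    define A where "A = (\<beta> / d) powr (1 - p)"
    define B where "B = (\<alpha> / c) powr (- 1 / (p - 1))"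
    have "average Q w \<le> ennreal A * average Q u"
    proof (rule average_le_cmult[OF Q])
      show "AE x in lebesgue. x \<in> Q \<longrightarrow> w x \<le> A * u x"
        using \<beta>(3)
      proof eventually_elim
        case (elim x)
        show ?case
        proof
          assume "x \<in> Q"
          then have "v x powr (1 - p) \<le> A" unfolding A_def using elim \<beta>(1) d p by (intro powr_mono2') auto
          then show "w x \<le> A * u x"
            using A1_boundD(2)[OF u, of x] by (simp add: w_def mult.commute[of A] mult_left_mono)
        qed
      qed
    qed (simp_all add: A_def)
    then have 1: "average Q w \<le> ennreal (A * \<alpha>)" using \<alpha> by (simp add: A_def ennreal_mult)
    then show "average Q w < \<infinity>" by (rule le_less_trans) simp
    have "average Q (\<lambda>x. w x powr (- 1 / (p - 1))) \<le> ennreal B * average Q v"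
    proof (rule average_le_cmult[OF Q])
      show "AE x in lebesgue. x \<in> Q \<longrightarrow> w x powr (- 1 / (p - 1)) \<le> B * v x"
        using \<alpha>(3) A1_boundD(3)[OF v]
      proof eventually_elim
        case (elim x)
        show ?case
        proof
          assume x: "x \<in> Q"
          have "u x powr (- 1 / (p - 1)) \<le> B" unfolding B_def
            using elim \<alpha>(1) c p x by (intro powr_mono2') (auto simp: divide_simps)
          \<comment> \<open>The dual exponent turns the negative power of v back into v itself,
            whose average is known.\<close>
          moreover have "(1 - p) * (- 1 / (p - 1)) = 1" using p by (simp add: divide_simps)
          then have "w x powr (- 1 / (p - 1)) = u x powr (- 1 / (p - 1)) * v x"
            using elim A1_boundD(2)[OF u, of x] by (simp add: w_def powr_mult powr_powr)
          ultimately show "w x powr (- 1 / (p - 1)) \<le> B * v x"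
            using elim by (simp add: mult_right_mono)
        qed
      qed
    qed (simp_all add: B_def)
    then have "average Q (\<lambda>x. w x powr (- 1 / (p - 1))) \<le> ennreal (B * \<beta>)"
      using \<beta> by (simp add: B_def ennreal_mult)
    then have "epowr (average Q (\<lambda>x. w x powr (- 1 / (p - 1)))) (p - 1) \<le> epowr (ennreal (B * \<beta>)) (p - 1)"
      using p by (intro epowr_mono) auto
    also have "\<dots> = ennreal ((B * \<beta>) powr (p - 1))" using \<beta> by (intro epowr_ennreal) (simp add: B_def)
    finally have "average Q w * epowr (average Q (\<lambda>x. w x powr (- 1 / (p - 1)))) (p - 1)
        \<le> ennreal (A * \<alpha>) * ennreal ((B * \<beta>) powr (p - 1))"
      using 1 by (intro mult_mono) auto
    also have "\<dots> = ennreal (A * \<alpha> * (B * \<beta>) powr (p - 1))"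
      using \<alpha> by (intro ennreal_mult[symmetric]) (auto simp: A_def)
    also have "A * \<alpha> * (B * \<beta>) powr (p - 1) = c * d powr (p - 1)"
    proof -
      have e: "- 1 / (p - 1) * (p - 1) = - 1" using p by simp
      have "B powr (p - 1) = (\<alpha> / c) powr (- 1)" unfolding B_def by (simp only: powr_powr e)
      then have "B powr (p - 1) = c / \<alpha>" using \<alpha> c by (simp add: powr_minus_divide)
      moreover have "A = d powr (p - 1) / \<beta> powr (p - 1)"
        using \<beta> d powr_minus_divide[of "\<beta> / d" "p - 1"] by (simp add: A_def powr_divide)
      ultimately show ?thesis using \<alpha> \<beta> by (simp add: powr_mult B_def)
    qed
    finally show "average Q w * epowr (average Q (\<lambda>x. w x powr (- 1 / (p - 1)))) (p - 1) \<le> ennreal (c * d powr (p - 1))" .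
  qed
  from bounds(2) show le: "Muckenhoupt_const p w \<le> ennreal (c * d powr (p - 1))"
    unfolding Muckenhoupt_const_def using p by (auto intro!: SUP_least)
  have "AE x in lebesgue. 0 < w x"
    using A1_boundD(3)[OF u] A1_boundD(3)[OF v] by eventually_elim (simp add: w_def)
  moreover have "0 \<le> w x" for x using A1_boundD(2)[OF u] by (simp add: w_def)
  ultimately have "weight w" using bounds(1) by (auto simp: weight_def intro!: locally_integrableI)
  then show "w \<in> Muckenhoupt p" using le_less_trans[OF le] by (simp add: Muckenhoupt_def)
qed

text \<open>Local boundedness controls \<phi> on positive arguments only, so the norm has to be
  shown nonzero before \<phi> can be bounded there.\<close>

lemma Muckenhoupt_norm_pos:
  fixes w :: "real ^ 'n \<Rightarrow> real"
  assumes w: "w \<in> Muckenhoupt p"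
  shows "0 < Muckenhoupt_norm p w"
proof -
  define Q where "Q = cube (0 :: real ^ 'n) 1"
  have Q: "Q \<in> cubes" by (simp add: Q_def cube_in_cubes)
  have pos: "AE x in lebesgue. 0 < w x" and [measurable]: "w \<in> borel_measurable lebesgue"
    using w by (simp_all add: Muckenhoupt_def weight_def locally_integrable_measurable)
  have av: "0 < average Q w" using pos by (intro average_pos[OF Q]) auto
  have "0 < Muckenhoupt_const p w"
  proof (cases "p = 1")
    case True
    have "AE x in lebesgue. x \<in> Q \<longrightarrow> ennreal (inverse (w x)) \<le> esssup (restrict_space lebesgue Q) (\<lambda>x. ennreal (inverse (w x)))"
      using esssup_AE[of "\<lambda>x. ennreal (inverse (w x))" "restrict_space lebesgue Q"] emeasure_cubes(3)[OF Q]
      by (subst (asm) AE_restrict_space_iff) auto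
    with pos have ess: "AE x in lebesgue. x \<in> Q \<longrightarrow> 0 < esssup (restrict_space lebesgue Q) (\<lambda>x. ennreal (inverse (w x)))"
    proof eventually_elim
      case (elim x)
      then have "0 < ennreal (inverse (w x))" by simp
      then show ?case using elim(2) less_le_trans by blast
    qed
    have "0 < esssup (restrict_space lebesgue Q) (\<lambda>x. ennreal (inverse (w x)))"
      using AE_cube_ex[OF Q ess] by blast
    with av have "0 < average Q w * esssup (restrict_space lebesgue Q) (\<lambda>x. ennreal (inverse (w x)))"
      by (simp add: ennreal_zero_less_mult_iff)
    also have "\<dots> \<le> Muckenhoupt_const p w" unfolding Muckenhoupt_const_def if_P[OF True] by (rule SUP_upper[OF Q])
    finally show ?thesis .
  next
    case False
    have "0 < average Q (\<lambda>x. w x powr (- 1 / (p - 1)))"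
      using pos by (intro average_pos[OF Q]) auto
    with av have "0 < average Q w * epowr (average Q (\<lambda>x. w x powr (- 1 / (p - 1)))) (p - 1)"
      by (simp add: zero_less_iff_neq_zero)
    also have "\<dots> \<le> Muckenhoupt_const p w" unfolding Muckenhoupt_const_def if_not_P[OF False] by (rule SUP_upper[OF Q])
    finally show ?thesis .
  qed
  then show ?thesis using w by (simp add: Muckenhoupt_norm_def Muckenhoupt_def enn2real_positive_iff)
qed

section \<open>Powers of maximal functions as weights\<close>

lemma AE_le_maximal_pow:
  fixes f :: "real ^ 'n \<Rightarrow> real"
  assumes [measurable]: "f \<in> borel_measurable lebesgue" and \<mu>: "0 < \<mu>"
  shows "AE x in lebesgue. ennreal \<bar>f x\<bar> \<le> maximal_pow \<mu> f x"
proof -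
  have "AE x in lebesgue. ennreal \<bar>\<bar>f x\<bar> powr (1 / \<mu>)\<bar> \<le> maximal (\<lambda>y. \<bar>f y\<bar> powr (1 / \<mu>)) x"
    by (rule AE_le_maximal) measurable
  then show ?thesis
  proof eventually_elim
    case (elim x)
    then have "epowr (ennreal (\<bar>f x\<bar> powr (1 / \<mu>))) \<mu> \<le> maximal_pow \<mu> f x"
      unfolding maximal_pow_def using \<mu> by (intro epowr_mono) auto
    moreover have "epowr (ennreal (\<bar>f x\<bar> powr (1 / \<mu>))) \<mu> = ennreal \<bar>f x\<bar>"
      using \<mu> by (simp add: powr_powr)
    ultimately show ?case by simp
  qed
qed

text \<open>If the maximal function vanished at one point, f would vanish almost everywhere on each
  cube through it, and these exhaust the space.\<close>

lemma maximal_pos: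
  fixes f :: "real ^ 'n \<Rightarrow> real"
  assumes [measurable]: "f \<in> borel_measurable lebesgue" and nz: "\<not> (AE x in lebesgue. f x = 0)"
  shows "0 < maximal f x"
proof (rule ccontr)
  assume "\<not> 0 < maximal f x"
  then have 0: "maximal f x = 0" by simp
  have "AE z in lebesgue. z \<in> Q \<longrightarrow> f z = 0" if Q: "Q \<in> cubes" "x \<in> Q" for Q
  proof -
    have [measurable]: "Q \<in> sets lebesgue" using emeasure_cubes[OF Q(1)] by simp
    have "average Q (\<lambda>y. \<bar>f y\<bar>) = 0" using average_le_maximal[OF Q, of f] 0 by simp
    then have "(\<integral>\<^sup>+ z \<in> Q. ennreal \<bar>f z\<bar> \<partial>lebesgue) = 0" by (simp add: nn_integral_cubes[OF Q(1)])
    then have "AE z in lebesgue. ennreal \<bar>f z\<bar> * indicator Q z = 0"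
      by (subst (asm) nn_integral_0_iff_AE) auto
    then show ?thesis by eventually_elim (auto simp: ennreal_eq_0_iff split: split_indicator_asm)
  qed
  then have "AE z in lebesgue. f z = 0" by (rule AE_if_AE_cubes)
  with nz show False by simp
qed

lemma maximal_pow_measurable [measurable]: "maximal_pow \<mu> f \<in> borel_measurable lebesgue"
  unfolding maximal_pow_def by measurable

text \<open>The Coifman-Rochberg bound at \<open>x\<^sub>0\<close> makes the integral over every
  cube through \<open>x\<^sub>0\<close> finite, hence the function is finite almost everywhere. At
  each such finite point the same bound is the A_1 condition. The constant is fixed before
  f.\<close>

lemma maximal_pow_A1:
  assumes \<mu>: "0 < \<mu>" "\<mu> < 1"
  obtains c where "0 < c"
    "\<And>(f :: real ^ 'n \<Rightarrow> real) x\<^sub>0. f \<in> borel_measurable lebesgue \<Longrightarrow> \<not> (AE x in lebesgue. f x = 0) \<Longrightarrow>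
      maximal_pow \<mu> f x\<^sub>0 < \<infinity> \<Longrightarrow>
      A1_bound c (\<lambda>x. enn2real (maximal_pow \<mu> f x)) \<and>
      (AE x in lebesgue. 0 < maximal_pow \<mu> f x \<and> maximal_pow \<mu> f x < \<infinity>)"
proof -
  obtain C where C: "0 < C" "\<And>(f :: real ^ 'n \<Rightarrow> real) Q x. f \<in> borel_measurable lebesgue \<Longrightarrow> Q \<in> cubes \<Longrightarrow> x \<in> Q \<Longrightarrow>
    0 < maximal f x \<Longrightarrow>
    (\<integral>\<^sup>+ z \<in> Q. epowr (maximal f z) \<mu> \<partial>lebesgue) \<le> ennreal C * epowr (maximal f x) \<mu> * emeasure lebesgue Q"
    using coifman_rochberg[OF \<mu>] by blast
  show ?thesis
  proof (rule that[OF C(1)])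
    fix f :: "real ^ 'n \<Rightarrow> real" and x\<^sub>0
    assume [measurable]: "f \<in> borel_measurable lebesgue" and nz: "\<not> (AE x in lebesgue. f x = 0)"
      and fin: "maximal_pow \<mu> f x\<^sub>0 < \<infinity>"
    define F where "F = (\<lambda>y. \<bar>f y\<bar> powr (1 / \<mu>))"
    have F [measurable]: "F \<in> borel_measurable lebesgue" unfolding F_def by measurable
    define W where "W = maximal_pow \<mu> f"
    have W: "W x = epowr (maximal F x) \<mu>" for x by (simp add: W_def maximal_pow_def F_def)
    have [measurable]: "W \<in> borel_measurable lebesgue" by (simp add: W_def)
    have "\<not> (AE x in lebesgue. F x = 0)" using nz by (simp add: F_def)
    then have pos: "0 < maximal F x" for x by (intro maximal_pos) auto
    then have Wpos: "0 < W x" for x by (simp add: W zero_less_iff_neq_zero)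
    have CR: "(\<integral>\<^sup>+ z \<in> Q. W z \<partial>lebesgue) \<le> ennreal C * W x * emeasure lebesgue Q" if "Q \<in> cubes" "x \<in> Q" for Q x
      using C(2)[OF F that pos] by (simp add: W)
    have AEfin: "AE x in lebesgue. W x < \<infinity>"
    proof (rule AE_if_AE_cubes[of x\<^sub>0])
      fix Q :: "(real ^ 'n) set" assume Q: "Q \<in> cubes" "x\<^sub>0 \<in> Q"
      have [measurable]: "Q \<in> sets lebesgue" using emeasure_cubes[OF Q(1)] by simp
      have "(\<integral>\<^sup>+ z \<in> Q. W z \<partial>lebesgue) \<noteq> \<infinity>"
      proof -
        have "ennreal C * W x\<^sub>0 * emeasure lebesgue Q < \<infinity>"
          using fin emeasure_cubes(2)[OF Q(1)] by (simp add: W_def ennreal_mult_less_top)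
        then show ?thesis using CR[OF Q] by (auto simp: top_unique)
      qed
      then have "AE z in lebesgue. W z * indicator Q z \<noteq> \<infinity>" by (intro nn_integral_PInf_AE) auto
      then show "AE z in lebesgue. z \<in> Q \<longrightarrow> W z < \<infinity>"
        by eventually_elim (auto simp: less_top)
    qed
    have "A1_bound C (\<lambda>x. enn2real (W x))"
      unfolding A1_bound_def
    proof (intro conjI allI ballI)
      show "AE x in lebesgue. 0 < enn2real (W x)"
        using AEfin by eventually_elim (simp add: enn2real_positive_iff Wpos)
      fix Q :: "(real ^ 'n) set" assume Q: "Q \<in> cubes"
      show "AE x in lebesgue. x \<in> Q \<longrightarrow> average Q (\<lambda>x. enn2real (W x)) \<le> ennreal (C * enn2real (W x))"
        using AEfin
      proof eventually_elim
        case (elim x)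
        show ?case
        proof
          assume x: "x \<in> Q"
          \<comment> \<open>Replacing infinite values by 0 can only lower the average.\<close>
          have "(\<integral>\<^sup>+ z \<in> Q. ennreal (enn2real (W z)) \<partial>lebesgue) \<le> (\<integral>\<^sup>+ z \<in> Q. W z \<partial>lebesgue)"
          proof (intro nn_integral_mono mult_right_mono)
            show "ennreal (enn2real (W z)) \<le> W z" for z by (cases "W z") auto
          qed simp
          also note CR[OF Q x]
          also have "ennreal C * W x = ennreal (C * enn2real (W x))"
            using C(1) elim by (simp add: ennreal_mult)
          finally show "average Q (\<lambda>x. enn2real (W x)) \<le> ennreal (C * enn2real (W x))"
            by (rule average_cubes_le[OF Q])
        qed
      qed
    qed auto
    then show "A1_bound C (\<lambda>x. enn2real (maximal_pow \<mu> f x)) \<and>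
      (AE x in lebesgue. 0 < maximal_pow \<mu> f x \<and> maximal_pow \<mu> f x < \<infinity>)"
      using AEfin Wpos by (simp add: W_def)
  qed
qed

lemma A1_bound_1: "A1_bound 1 (\<lambda>_ :: real ^ 'n. 1)"
proof -
  have "average Q (\<lambda>_. 1) = 1" if "Q \<in> cubes" for Q :: "(real ^ 'n) set"
    using emeasure_cubes[OF that] by (simp add: average_def ennreal_divide_self)
  then show ?thesis by (simp add: A1_bound_def)
qed

lemma epowr_cmult: "0 < c \<Longrightarrow> epowr (ennreal c * x) s = ennreal (c powr s) * epowr x s"
  by (cases x) (auto simp: ennreal_mult_top ennreal_mult[symmetric] powr_mult)

lemma epowr_epowr_inverse: "0 < p \<Longrightarrow> epowr (epowr x (1 / p)) p = x"
  by (cases x) (auto simp: powr_powr)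

lemma distr_fun_le_of_weak_Lp:
  assumes p: "1 \<le> p" and B: "0 < B" and y: "0 < y"
    and le: "weak_Lp_norm p w g \<le> ennreal B * Lp_norm p w f"
  shows "distr_fun w (\<lambda>x. ennreal \<bar>g x\<bar>) y
    \<le> ennreal ((B / y) powr p) * (\<integral>\<^sup>+ x. ennreal (\<bar>f x\<bar> powr p * w x) \<partial>lebesgue)" (is "?D \<le> _ * ?I")
proof -
  have "ennreal y * epowr ?D (1 / p) \<le> weak_Lp_norm p w g"
    unfolding weak_Lp_norm_def using y by (intro SUP_upper) auto
  also note le
  finally have "epowr (ennreal y * epowr ?D (1 / p)) p \<le> epowr (ennreal B * epowr ?I (1 / p)) p"
    using p by (intro epowr_mono) (auto simp: Lp_norm_def)
  then have "ennreal (y powr p) * ?D \<le> ennreal (B powr p) * ?I"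
    using p y B by (simp add: epowr_cmult epowr_epowr_inverse)
  then have "ennreal (1 / y powr p) * (ennreal (y powr p) * ?D) \<le> ennreal (1 / y powr p) * (ennreal (B powr p) * ?I)"
    by (rule mult_left_mono) simp
  then show ?thesis
    using y B by (simp add: mult.assoc[symmetric] ennreal_mult[symmetric] powr_divide)
qed

text \<open>Serves the case of an identically infinite maximal function: since 0 times \<infinity>
  is 0, f has to be nonzero on a set of positive measure.\<close>

lemma nn_integral_top:
  assumes "\<not> (AE x in M. f x = 0)" "f \<in> borel_measurable M"
  shows "(\<integral>\<^sup>+ x. f x * \<infinity> \<partial>M) = \<infinity>"
proof -
  have "(\<integral>\<^sup>+ x. f x * \<infinity> \<partial>M) = (\<integral>\<^sup>+ x. f x \<partial>M) * \<infinity>" using assms by (intro nn_integral_multc) auto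
  moreover have "(\<integral>\<^sup>+ x. f x \<partial>M) \<noteq> 0" using assms by (simp add: nn_integral_0_iff_AE)
  ultimately show ?thesis by (simp add: ennreal_mult_top)
qed

section \<open>Extrapolation\<close>

lemma distr_fun_eq:
  assumes "0 < y"
  shows "distr_fun v (\<lambda>x. ennreal (g x)) y = (\<integral>\<^sup>+ x. ennreal (v x * indicator {z. g z > y} x) \<partial>lebesgue)"
  unfolding distr_fun_def
proof (intro nn_integral_cong)
  fix x
  have "ennreal y < ennreal (g x) \<longleftrightarrow> y < g x" using assms by (simp add: ennreal_less_iff)
  then show "ennreal (v x) * indicator {x. ennreal y < ennreal (g x)} x = ennreal (v x * indicator {z. g z > y} x)"
    by (simp split: split_indicator)
qed

text \<open>The endpoint estimate has no term with \<open>maximal_pow \<delta> f\<close>, as no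
  power of it enters the weight. Finiteness almost everywhere matters for |h| \<le> w, since w is 0
  wherever the maximal function is infinite.\<close>

lemma distr_fun_bound_1:
  fixes f g u :: "real ^ 'n \<Rightarrow> real" and y :: real
  defines "h \<equiv> \<lambda>z. u z * indicator {z. g z > y} z"
  assumes \<mu>: "0 < \<mu>" and B: "0 < B" and y: "0 < y"
    and f: "\<And>x. 0 \<le> f x" and g: "\<And>x. 0 \<le> g x" and hm: "h \<in> borel_measurable lebesgue"
    and fin: "AE x in lebesgue. maximal_pow \<mu> h x < \<infinity>"
  defines "w \<equiv> \<lambda>x. enn2real (maximal_pow \<mu> h x)"
  assumes weak: "weak_Lp_norm 1 w g \<le> ennreal B * Lp_norm 1 w f"
  shows "distr_fun u (\<lambda>x. ennreal (g x)) y
    \<le> ennreal (B / y) * (\<integral>\<^sup>+ x. ennreal (f x) * maximal_pow \<mu> h x \<partial>lebesgue)"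
proof -
  have "distr_fun u (\<lambda>x. ennreal (g x)) y \<le> distr_fun w (\<lambda>x. ennreal \<bar>g x\<bar>) y"
    unfolding abs_of_nonneg[OF g] distr_fun_eq[OF y]
  proof (rule nn_integral_mono_AE)
    show "AE x in lebesgue. ennreal (u x * indicator {z. g z > y} x) \<le> ennreal (w x * indicator {z. g z > y} x)"
      using AE_le_maximal_pow[OF hm \<mu>] fin
    proof eventually_elim
      case (elim x)
      obtain a where a: "0 \<le> a" "maximal_pow \<mu> h x = ennreal a" using elim(2) by (cases "maximal_pow \<mu> h x") auto
      then have "\<bar>h x\<bar> \<le> a" using elim(1) by (simp add: ennreal_le_iff)
      then have "u x * indicator {z. g z > y} x \<le> w x * indicator {z. g z > y} x"
        using a by (auto simp: h_def w_def split: split_indicator)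
      then show ?case by (rule ennreal_leI)
    qed
  qed
  also have "\<dots> \<le> ennreal (B / y) * (\<integral>\<^sup>+ x. ennreal (\<bar>f x\<bar> powr 1 * w x) \<partial>lebesgue)"
    using distr_fun_le_of_weak_Lp[OF _ B y weak] B y by simp
  also have "\<dots> \<le> ennreal (B / y) * (\<integral>\<^sup>+ x. ennreal (f x) * maximal_pow \<mu> h x \<partial>lebesgue)"
  proof (intro mult_left_mono nn_integral_mono)
    fix x
    have "ennreal (w x) \<le> maximal_pow \<mu> h x" by (cases "maximal_pow \<mu> h x") (auto simp: w_def)
    then show "ennreal (\<bar>f x\<bar> powr 1 * w x) \<le> ennreal (f x) * maximal_pow \<mu> h x"
      using f[of x] by (simp add: ennreal_mult' mult_left_mono)
  qed simp
  finally show ?thesis .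
qed

text \<open>V^(1-p) has two uses: outside {V > y} it is at least y^(1-p), so w controls u there, and
  against f^p it absorbs all but one power of f because f \<le> V. Both pointwise comparisons use
  that U and V are finite almost everywhere.\<close>

lemma distr_fun_bound:
  fixes f g u :: "real ^ 'n \<Rightarrow> real" and y :: real
  defines "h \<equiv> \<lambda>z. u z * indicator {z. g z > y} z"
  assumes \<mu>: "0 < \<mu>" and \<delta>: "0 < \<delta>" and p: "1 < p" and B: "0 < B" and y: "0 < y"
    and fm [measurable]: "f \<in> borel_measurable lebesgue" and f: "\<And>x. 0 \<le> f x"
    and gm [measurable]: "g \<in> borel_measurable lebesgue" and g: "\<And>x. 0 \<le> g x"
    and um [measurable]: "u \<in> borel_measurable lebesgue" and u: "\<And>x. 0 \<le> u x"
    and U: "AE x in lebesgue. maximal_pow \<mu> h x < \<infinity>"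
    and V: "AE x in lebesgue. 0 < maximal_pow \<delta> f x \<and> maximal_pow \<delta> f x < \<infinity>"
  defines "w \<equiv> \<lambda>x. enn2real (maximal_pow \<mu> h x) * enn2real (maximal_pow \<delta> f x) powr (1 - p)"
  assumes weak: "weak_Lp_norm p w g \<le> ennreal B * Lp_norm p w f"
  shows "distr_fun u (\<lambda>x. ennreal (g x)) y
    \<le> distr_fun u (maximal_pow \<delta> f) y
      + ennreal (B powr p / y) * (\<integral>\<^sup>+ x. ennreal (f x) * maximal_pow \<mu> h x \<partial>lebesgue)"
proof -
  define G where "G = {z. g z > y}"
  have G [measurable]: "G \<in> sets lebesgue"
  proof -
    have "{z \<in> space lebesgue. g z > y} \<in> sets lebesgue" by measurable
    then show ?thesis by (simp add: G_def)
  qed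
  have hm [measurable]: "h \<in> borel_measurable lebesgue"
    unfolding h_def G_def[symmetric] by measurable
  have wm [measurable]: "w \<in> borel_measurable lebesgue" unfolding w_def by measurable
  have w0: "0 \<le> w x" for x by (simp add: w_def)
  define E where "E = {x. ennreal y < maximal_pow \<delta> f x}"
  have [measurable]: "E \<in> sets lebesgue"
  proof -
    have "{x \<in> space lebesgue. ennreal y < maximal_pow \<delta> f x} \<in> sets lebesgue" by measurable
    then show ?thesis by (simp add: E_def)
  qed
  have "distr_fun u (\<lambda>x. ennreal (g x)) y
      \<le> (\<integral>\<^sup>+ x. ennreal (u x) * indicator E x + ennreal (y powr (p - 1)) * ennreal (w x * indicator G x) \<partial>lebesgue)"
    unfolding distr_fun_eq[OF y] G_def[symmetric]
  proof (rule nn_integral_mono_AE)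
    show "AE x in lebesgue. ennreal (u x * indicator G x)
        \<le> ennreal (u x) * indicator E x + ennreal (y powr (p - 1)) * ennreal (w x * indicator G x)"
      using AE_le_maximal_pow[OF hm \<mu>] U V
    proof eventually_elim
      case (elim x)
      show ?case
      \<comment> \<open>Outside G the left side vanishes, and on E the first summand already
        dominates.\<close>
      proof (cases "x \<in> G \<and> x \<notin> E")
        case True
        obtain a where a: "0 \<le> a" "maximal_pow \<mu> h x = ennreal a"
          using elim(2) by (cases "maximal_pow \<mu> h x") auto
        obtain v where v: "0 < v" "maximal_pow \<delta> f x = ennreal v"
          using elim(3) by (cases "maximal_pow \<delta> f x") auto
        have "u x \<le> a" using elim(1) True u[of x] a by (simp add: h_def G_def ennreal_le_iff)
        moreover have "v \<le> y" using True v y by (simp add: E_def ennreal_less_iff not_less)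
        then have "1 \<le> (y / v) powr (p - 1)" using v p by (intro ge_one_powr_ge_zero) auto
        then have "a * 1 \<le> a * (y / v) powr (p - 1)" using a by (intro mult_left_mono)
        moreover have "(y / v) powr (p - 1) = y powr (p - 1) * v powr (1 - p)"
          using y v powr_minus_divide[of v "p - 1"] by (simp add: powr_divide)
        ultimately have "u x \<le> y powr (p - 1) * w x" using a v by (simp add: w_def mult_ac)
        then show ?thesis using True by (simp add: ennreal_mult'[symmetric] ennreal_leI)
      qed (auto split: split_indicator)
    qed
  qed
  also have "\<dots> = distr_fun u (maximal_pow \<delta> f) y + ennreal (y powr (p - 1)) * distr_fun w (\<lambda>x. ennreal \<bar>g x\<bar>) y"
    unfolding abs_of_nonneg[OF g] distr_fun_eq[OF y] G_def[symmetric]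
    by (subst nn_integral_add) (auto simp: nn_integral_cmult distr_fun_def E_def[symmetric])
  also have "\<dots> \<le> distr_fun u (maximal_pow \<delta> f) y + ennreal (y powr (p - 1)) *
      (ennreal ((B / y) powr p) * (\<integral>\<^sup>+ x. ennreal (f x) * maximal_pow \<mu> h x \<partial>lebesgue))"
  proof (intro add_left_mono mult_left_mono)
    have "distr_fun w (\<lambda>x. ennreal \<bar>g x\<bar>) y \<le> ennreal ((B / y) powr p) * (\<integral>\<^sup>+ x. ennreal (\<bar>f x\<bar> powr p * w x) \<partial>lebesgue)"
      using p by (intro distr_fun_le_of_weak_Lp B y weak) auto
    also have "(\<integral>\<^sup>+ x. ennreal (\<bar>f x\<bar> powr p * w x) \<partial>lebesgue) \<le> (\<integral>\<^sup>+ x. ennreal (f x) * maximal_pow \<mu> h x \<partial>lebesgue)"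
    proof (rule nn_integral_mono_AE)
      show "AE x in lebesgue. ennreal (\<bar>f x\<bar> powr p * w x) \<le> ennreal (f x) * maximal_pow \<mu> h x"
        using AE_le_maximal_pow[OF fm \<delta>] U V
      proof eventually_elim
        case (elim x)
        obtain a where a: "0 \<le> a" "maximal_pow \<mu> h x = ennreal a"
          using elim(2) by (cases "maximal_pow \<mu> h x") auto
        obtain v where v: "0 < v" "maximal_pow \<delta> f x = ennreal v"
          using elim(3) by (cases "maximal_pow \<delta> f x") auto
        have "f x \<le> v" using elim(1) v f[of x] by (simp add: ennreal_le_iff)
        then have "f x powr (p - 1) \<le> v powr (p - 1)" using f[of x] p by (intro powr_mono2) auto
        then have "f x powr (p - 1) * v powr (1 - p) \<le> v powr (p - 1) * v powr (1 - p)" by (rule mult_right_mono) simp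
        also have "\<dots> = 1" using v by (simp add: powr_add[symmetric])
        finally have "f x * a * (f x powr (p - 1) * v powr (1 - p)) \<le> f x * a * 1"
          using f[of x] a by (intro mult_left_mono) auto
        moreover have "f x powr p = f x * f x powr (p - 1)"
          using f[of x] p by (cases "f x = 0") (auto simp: powr_mult_base)
        ultimately have "\<bar>f x\<bar> powr p * w x \<le> f x * a"
          using f[of x] a v by (simp add: w_def mult_ac)
        then show ?case using f[of x] a by (simp add: ennreal_mult[symmetric] ennreal_leI)
      qed
    qed
    finally show "distr_fun w (\<lambda>x. ennreal \<bar>g x\<bar>) y
      \<le> ennreal ((B / y) powr p) * (\<integral>\<^sup>+ x. ennreal (f x) * maximal_pow \<mu> h x \<partial>lebesgue)"
      by (simp add: mult_left_mono)
  qed simp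
  also have "ennreal (y powr (p - 1)) * (ennreal ((B / y) powr p) * (\<integral>\<^sup>+ x. ennreal (f x) * maximal_pow \<mu> h x \<partial>lebesgue))
      = ennreal (B powr p / y) * (\<integral>\<^sup>+ x. ennreal (f x) * maximal_pow \<mu> h x \<partial>lebesgue)"
  proof -
    \<comment> \<open>The factor y^(p-1) of the splitting meets y^(-p) of the weak-type bound,
      leaving 1/y.\<close>
    have "y powr (p - 1) * (B / y) powr p = B powr p / y"
      using y B by (simp add: powr_divide powr_diff)
    then show ?thesis by (simp add: mult.assoc[symmetric] ennreal_mult[symmetric])
  qed
  finally show ?thesis .
qed

lemma one_in_Muckenhoupt:
  assumes "1 \<le> p" shows "(\<lambda>_ :: real ^ 'n. 1) \<in> Muckenhoupt p"
proof (cases "p = 1")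
  case True
  then show ?thesis using A1_bound_Muckenhoupt_1(1)[OF A1_bound_1] by simp
next
  case False
  then show ?thesis using A1_bound_Muckenhoupt(1)[OF _ A1_bound_1 A1_bound_1, of p] assms by simp
qed

theorem theorem2p2:
  fixes p\<^sub>0 \<mu> \<delta> :: real and \<phi> :: "real \<Rightarrow> real"
  assumes "1 \<le> p\<^sub>0" and "0 < \<mu>" "\<mu> < 1" and "0 < \<delta>" "\<delta> < 1" and "locally_bounded \<phi>"
  shows "\<exists>C>0. \<forall>f g :: real ^ 'n \<Rightarrow> real.
    f \<in> borel_measurable lebesgue \<longrightarrow> (\<forall>x. 0 \<le> f x) \<longrightarrow>
    g \<in> borel_measurable lebesgue \<longrightarrow> (\<forall>x. 0 \<le> g x) \<longrightarrow>
    (\<forall>w \<in> Muckenhoupt p\<^sub>0.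
        weak_Lp_norm p\<^sub>0 w g \<le> ennreal (\<phi> (Muckenhoupt_norm p\<^sub>0 w)) * Lp_norm p\<^sub>0 w f) \<longrightarrow>
    (\<forall>u y. locally_integrable u \<longrightarrow> (\<forall>x. 0 \<le> u x) \<longrightarrow> 0 < y \<longrightarrow>
        distr_fun u (\<lambda>x. ennreal (g x)) y
        \<le> ennreal C * ((if p\<^sub>0 > 1 then 1 else 0) * distr_fun u (maximal_pow \<delta> f) y
             + ennreal (1 / y) *
               (\<integral>\<^sup>+ x. ennreal (f x) * maximal_pow \<mu> (\<lambda>z. u z * indicator {z. g z > y} z) x \<partial>lebesgue)))"
proof -
  obtain c where c: "0 < c" and A1_\<mu>: "\<And>(f :: real ^ 'n \<Rightarrow> real) x\<^sub>0. f \<in> borel_measurable lebesgue \<Longrightarrow>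
      \<not> (AE x in lebesgue. f x = 0) \<Longrightarrow> maximal_pow \<mu> f x\<^sub>0 < \<infinity> \<Longrightarrow>
      A1_bound c (\<lambda>x. enn2real (maximal_pow \<mu> f x)) \<and>
      (AE x in lebesgue. 0 < maximal_pow \<mu> f x \<and> maximal_pow \<mu> f x < \<infinity>)"
    by (rule maximal_pow_A1[OF assms(2,3)]) blast
  obtain d where d: "0 < d" and A1_\<delta>: "\<And>(f :: real ^ 'n \<Rightarrow> real) x\<^sub>0. f \<in> borel_measurable lebesgue \<Longrightarrow>
      \<not> (AE x in lebesgue. f x = 0) \<Longrightarrow> maximal_pow \<delta> f x\<^sub>0 < \<infinity> \<Longrightarrow>
      A1_bound d (\<lambda>x. enn2real (maximal_pow \<delta> f x)) \<and>
      (AE x in lebesgue. 0 < maximal_pow \<delta> f x \<and> maximal_pow \<delta> f x < \<infinity>)"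
    by (rule maximal_pow_A1[OF assms(4,5)]) blast
  \<comment> \<open>The factorization bound for the A_p constant; for \<open>p\<^sub>0 = 1\<close>
    it reduces to c, the A_1 bound.\<close>
  define K where "K = c * d powr (p\<^sub>0 - 1)"
  have K: "0 < K" using c d by (simp add: K_def)
  \<comment> \<open>The interval is taken up to K + 1 because it is open and the norm may equal
    K.\<close>
  obtain B\<^sub>0 where B0: "\<And>t. 0 < t \<Longrightarrow> t < K + 1 \<Longrightarrow> \<phi> t \<le> B\<^sub>0"
    using assms(6) K unfolding locally_bounded_def bdd_above_def
    by (smt (verit) greaterThanLessThan_iff image_eqI)
  \<comment> \<open>The maximum with 1 ensures positivity, whatever the sign of \<phi>.\<close>
  define B where "B = max 1 B\<^sub>0"
  have B: "0 < B" by (simp add: B_def)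
  \<comment> \<open>The summand 1 pays for the distribution function of
    \<open>maximal_pow \<delta> f\<close>, the other for the integral.\<close>
  define C where "C = 1 + B powr p\<^sub>0"
  have C: "1 \<le> C" "B powr p\<^sub>0 \<le> C" by (simp_all add: C_def)
  show ?thesis
  proof (intro exI[of _ C] conjI allI impI)
    show "0 < C" using C by simp
    fix f g u :: "real ^ 'n \<Rightarrow> real" and y :: real
    assume fm [measurable]: "f \<in> borel_measurable lebesgue" and f0: "\<forall>x. 0 \<le> f x"
      and gm [measurable]: "g \<in> borel_measurable lebesgue" and g0: "\<forall>x. 0 \<le> g x"
      and hyp: "\<forall>w \<in> Muckenhoupt p\<^sub>0.
        weak_Lp_norm p\<^sub>0 w g \<le> ennreal (\<phi> (Muckenhoupt_norm p\<^sub>0 w)) * Lp_norm p\<^sub>0 w f"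
      and u: "locally_integrable u" and u0: "\<forall>x. 0 \<le> u x" and y: "0 < y"
    have um [measurable]: "u \<in> borel_measurable lebesgue" using u by (rule locally_integrable_measurable)
    let ?h = "\<lambda>z. u z * indicator {z. g z > y} z"
    let ?I = "\<integral>\<^sup>+ x. ennreal (f x) * maximal_pow \<mu> ?h x \<partial>lebesgue"
    let ?D = "distr_fun u (maximal_pow \<delta> f) y"
    let ?L = "distr_fun u (\<lambda>x. ennreal (g x)) y"
    have "{z \<in> space lebesgue. g z > y} \<in> sets lebesgue" by measurable
    then have [measurable]: "{z. g z > y} \<in> sets lebesgue" by simp
    have hm: "?h \<in> borel_measurable lebesgue" by measurable
    have weak: "weak_Lp_norm p\<^sub>0 w g \<le> ennreal B * Lp_norm p\<^sub>0 w f"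
      if w: "w \<in> Muckenhoupt p\<^sub>0" and le: "Muckenhoupt_const p\<^sub>0 w \<le> ennreal K" for w
    proof -
      have "Muckenhoupt_norm p\<^sub>0 w \<le> K"
        unfolding Muckenhoupt_norm_def using le K by (intro enn2real_leI) auto
      then have "\<phi> (Muckenhoupt_norm p\<^sub>0 w) \<le> B"
        using B0[OF Muckenhoupt_norm_pos[OF w]] by (simp add: B_def)
      then have "ennreal (\<phi> (Muckenhoupt_norm p\<^sub>0 w)) * Lp_norm p\<^sub>0 w f \<le> ennreal B * Lp_norm p\<^sub>0 w f"
        by (intro mult_right_mono ennreal_leI) auto
      with hyp w show ?thesis by (meson order_trans)
    qed
    have scale: "ennreal (B powr p\<^sub>0 / y) * ?I \<le> ennreal C * (ennreal (1 / y) * ?I)"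
    proof -
      have "ennreal (B powr p\<^sub>0 / y) \<le> ennreal C * ennreal (1 / y)"
        using C y by (simp add: ennreal_mult[symmetric] divide_right_mono)
      then show ?thesis by (simp add: mult.assoc[symmetric] mult_right_mono)
    qed
    show "?L \<le> ennreal C * ((if p\<^sub>0 > 1 then 1 else 0) * ?D + ennreal (1 / y) * ?I)"
    \<comment> \<open>The cases in which U or V would not be a weight are removed first. The order
      matters: f being nonzero is needed to conclude that the integral is infinite when U
      is.\<close>
    proof (cases "AE x in lebesgue. f x = 0")
      case True
      let ?w = "\<lambda>_ :: real ^ 'n. 1 :: real"
      have "(\<integral>\<^sup>+ x. ennreal (\<bar>f x\<bar> powr p\<^sub>0 * ?w x) \<partial>lebesgue) = (\<integral>\<^sup>+ x. 0 \<partial>(lebesgue :: (real ^ 'n) measure))"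
        by (rule nn_integral_cong_AE, rule eventually_mono[OF True]) simp
      then have zero: "(\<integral>\<^sup>+ x. ennreal (\<bar>f x\<bar> powr p\<^sub>0 * ?w x) \<partial>lebesgue) = 0" by simp
      then have "Lp_norm p\<^sub>0 ?w f = 0" by (simp add: Lp_norm_def)
      then have "weak_Lp_norm p\<^sub>0 ?w g \<le> ennreal B * Lp_norm p\<^sub>0 ?w f"
        using hyp one_in_Muckenhoupt[OF assms(1)] by fastforce
      then have "distr_fun ?w (\<lambda>x. ennreal \<bar>g x\<bar>) y = 0"
        using distr_fun_le_of_weak_Lp[OF assms(1) B y] zero by fastforce
      then have "(\<integral>\<^sup>+ x. ennreal (indicator {z. g z > y} x) \<partial>lebesgue) = 0"
        using g0 by (simp add: distr_fun_eq[OF y])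
      then have ae: "AE x in lebesgue. ennreal (indicator {z. g z > y} x) = 0"
        by (subst (asm) nn_integral_0_iff_AE) auto
      have "?L = (\<integral>\<^sup>+ x. 0 \<partial>(lebesgue :: (real ^ 'n) measure))"
        unfolding distr_fun_eq[OF y]
        by (rule nn_integral_cong_AE, rule eventually_mono[OF ae]) (simp split: split_indicator_asm)
      then show ?thesis by simp
    next
      case f_nz: False
      show ?thesis
      proof (cases "AE x in lebesgue. ?h x = 0")
        case True
        \<comment> \<open>The left side is exactly the integral of \<open>?h\<close>.\<close>
        have "?L = (\<integral>\<^sup>+ x. 0 \<partial>(lebesgue :: (real ^ 'n) measure))"
          unfolding distr_fun_eq[OF y] by (rule nn_integral_cong_AE, rule eventually_mono[OF True]) (auto simp del: mult_eq_0_iff)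
        then show ?thesis by simp
      next
        case h_nz: False
        show ?thesis
        proof (cases "\<exists>x. maximal_pow \<mu> ?h x < \<infinity>")
          case False
          then have "maximal_pow \<mu> ?h x = \<infinity>" for x by (simp add: not_less top_unique)
          moreover have "ennreal (f x) = 0 \<longleftrightarrow> f x = 0" for x
            using f0 by (metis ennreal_0 ennreal_inj order_refl)
          then have "(\<integral>\<^sup>+ x. ennreal (f x) * \<infinity> \<partial>lebesgue) = \<infinity>"
            using f_nz by (intro nn_integral_top) simp_all
          ultimately have "?I = \<infinity>" by simp
          then show ?thesis using C y by (simp add: ennreal_mult_top)
        next
          case True
          then obtain x\<^sub>0 where x0: "maximal_pow \<mu> ?h x\<^sub>0 < \<infinity>" by blast
          note A = A1_\<mu>[OF hm h_nz x0]
          have U: "A1_bound c (\<lambda>x. enn2real (maximal_pow \<mu> ?h x))"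
            "AE x in lebesgue. maximal_pow \<mu> ?h x < \<infinity>"
            using conjunct1[OF A] eventually_mono[OF conjunct2[OF A]] by simp_all
          show ?thesis
          proof (cases "p\<^sub>0 = 1")
            case True
            have "?L \<le> ennreal (B / y) * ?I"
            proof (rule distr_fun_bound_1[OF assms(2) B y _ _ hm U(2)])
              show "weak_Lp_norm 1 (\<lambda>x. enn2real (maximal_pow \<mu> ?h x)) g
                  \<le> ennreal B * Lp_norm 1 (\<lambda>x. enn2real (maximal_pow \<mu> ?h x)) f"
                using weak A1_bound_Muckenhoupt_1[OF U(1) c] True d by (simp add: K_def)
            qed (use f0 g0 in auto)
            then show ?thesis using scale True B by simp
          next
            case False
            then have p: "1 < p\<^sub>0" using assms(1) by simp
            show ?thesis
            proof (cases "\<exists>x. maximal_pow \<delta> f x < \<infinity>")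
              case False
              then have "maximal_pow \<delta> f x = \<infinity>" for x by (simp add: not_less top_unique)
              \<comment> \<open>Here {V > y} is the whole space, so \<open>?D\<close> is the full
                integral of u.\<close>
              then have "?L \<le> ?D"
                unfolding distr_fun_def by (intro nn_integral_mono) (auto split: split_indicator)
              also have "\<dots> \<le> ennreal C * ?D"
                using C(1) mult_right_mono[of 1 "ennreal C" ?D] by simp
              also have "\<dots> \<le> ennreal C * (?D + ennreal (1 / y) * ?I)"
                by (intro mult_left_mono) auto
              finally show ?thesis using p by simp
            next
              case True
              then obtain x\<^sub>0 where x0: "maximal_pow \<delta> f x\<^sub>0 < \<infinity>" by blast
              have V: "A1_bound d (\<lambda>x. enn2real (maximal_pow \<delta> f x))"
                "AE x in lebesgue. 0 < maximal_pow \<delta> f x \<and> maximal_pow \<delta> f x < \<infinity>"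
                using A1_\<delta>[OF fm f_nz x0] by blast+
              have "?L \<le> ?D + ennreal (B powr p\<^sub>0 / y) * ?I"
              proof (rule distr_fun_bound[OF assms(2,4) p B y fm _ gm _ um _ U(2) V(2)])
                show "weak_Lp_norm p\<^sub>0 (\<lambda>x. enn2real (maximal_pow \<mu> ?h x) * enn2real (maximal_pow \<delta> f x) powr (1 - p\<^sub>0)) g
                  \<le> ennreal B * Lp_norm p\<^sub>0 (\<lambda>x. enn2real (maximal_pow \<mu> ?h x) * enn2real (maximal_pow \<delta> f x) powr (1 - p\<^sub>0)) f"
                  using A1_bound_Muckenhoupt[OF p U(1) V(1) c d] by (intro weak) (auto simp: K_def)
              qed (use f0 g0 u0 in auto)
              also have "\<dots> \<le> ennreal C * ?D + ennreal C * (ennreal (1 / y) * ?I)"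
                using C(1) mult_right_mono[of 1 "ennreal C" ?D] by (intro add_mono scale) simp
              finally show ?thesis using p by (simp add: distrib_left)
            qed
          qed
        qed
      qed
    qed
  qed
qed

end
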